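(* Let $N\ge2$, $R>0$, $p>1$, let $f$ be a non-negative radially decreasing function on $B_R$, and let $u_p\in W^{1,p}_0(B_R)$ be a weak solution of $$-\mathrm{div}\left((|\nabla u_p|-1)_+^{p-1}\frac{\nabla u_p}{|\nabla u_p|}\right)=f\ \text{ in } B_R,\qquad u_p=0\ \text{ on }\partial B_R .$$ (i) If $f\in L^{r,\infty}(B_R)$ with $1<r<N$, then $\nabla u_p\in L^q(B_R)$ for every $0<q<\dfrac{Nr(p-1)}{N-r}$. (ii) If $f\in L^{N,\infty}(B_R)$, then $\nabla u_p\in L^\infty(B_R)$.
   Context: $B_R=\{x\in\mathbb{R}^N:|x|<R\}$ and $(\cdot)_+$ is the positive part. For $\alpha>0$ put $H_\alpha(\xi)=(|\xi|-1)_+^{\alpha}\frac{\xi}{|\xi|}$ if $\xi\in\mathbb{R}^N\setminus\{0\}$ and $H_\alpha(0)=0$. Weak solution: $u\in W^{1,p}_0(B_R)$ is a weak solution of the Dirichlet problem if $\int_{B_R}\langle H_{p-1}(\nabla u),\nabla\varphi\rangle\,dx=\int_{B_R}f\varphi\,dx$ for all $\varphi\in C_0^\infty(B_R)$. Rearrangements: for measurable $f:B_R\to\mathbb{R}$, $\mu_f(\tau)=|\{x\in B_R:|f(x)|>\tau\}|$ for $\tau\ge0$; $f^*(\lambda)=\inf\{\tau\ge0:\mu_f(\tau)\le\lambda\}$ for $\lambda\ge0$; $f^{**}(t)=\frac1t\int_0^t f^*(s)\,ds$ for $t>0$. Lorentz space: for $1<r<\infty$, $L^{r,\infty}(B_R)$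 is the set of measurable $f$ with $\|f\|_{L^{r,\infty}}=\sup_{0<t<\infty}t^{1/r}f^{**}(t)<\infty$. "Radially decreasing" means that $f(x)$ depends only on $|x|$ and is a non-increasing function of $|x|$. *)

theory Defs
  imports "HOL-Analysis.Analysis"
begin

text \<open>
  The dimension \<open>N\<close> is \<open>DIM('a)\<close> for an arbitrary Euclidean space \<open>'a\<close>.  Functions on a domain
  \<open>\<Omega>\<close> are total functions on \<open>'a\<close>; apart from test functions, which vanish outside \<open>\<Omega>\<close>,
  only their values on \<open>\<Omega>\<close> matter.
\<close>

section \<open>Test functions\<close>

primrec iter_dir_deriv :: "'a::euclidean_space list \<Rightarrow> ('a \<Rightarrow> real) \<Rightarrow> 'a \<Rightarrow> real" where
  "iter_dir_deriv [] \<phi> = \<phi>"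
| "iter_dir_deriv (v # vs) \<phi> = (\<lambda>x. frechet_derivative (iter_dir_deriv vs \<phi>) (at x) v)"

definition smooth :: "('a::euclidean_space \<Rightarrow> real) \<Rightarrow> bool" where
  "smooth \<phi> \<longleftrightarrow> (\<forall>vs x. iter_dir_deriv vs \<phi> differentiable (at x))"

definition test_functions :: "'a::euclidean_space set \<Rightarrow> ('a \<Rightarrow> real) set" where
  "test_functions \<Omega> =
    {\<phi>. smooth \<phi> \<and> compact (closure {x. \<phi> x \<noteq> 0}) \<and> closure {x. \<phi> x \<noteq> 0} \<subseteq> \<Omega>}"

definition grad :: "('a::euclidean_space \<Rightarrow> real) \<Rightarrow> 'a \<Rightarrow> 'a" where
  "grad \<phi> x = (\<Sum>b\<in>Basis. frechet_derivative \<phi> (at x) b *\<^sub>R b)"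

section \<open>Lebesgue and Sobolev spaces\<close>

definition Lp_space ::
  "real \<Rightarrow> 'a::euclidean_space set \<Rightarrow> ('a \<Rightarrow> 'b::euclidean_space) set" where
  "Lp_space q \<Omega> = {g. g \<in> borel_measurable (lebesgue_on \<Omega>) \<and>
    integrable (lebesgue_on \<Omega>) (\<lambda>x. norm (g x) powr q)}"

definition Linf_space :: "'a::euclidean_space set \<Rightarrow> ('a \<Rightarrow> 'b::euclidean_space) set" where
  "Linf_space \<Omega> = {g. g \<in> borel_measurable (lebesgue_on \<Omega>) \<and>
    (\<exists>C. AE x in lebesgue_on \<Omega>. norm (g x) \<le> C)}"

definition Lp_norm ::
  "real \<Rightarrow> 'a::euclidean_space set \<Rightarrow> ('a \<Rightarrow> 'b::euclidean_space) \<Rightarrow> real" where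
  "Lp_norm p \<Omega> g = (\<integral>x. norm (g x) powr p \<partial>lebesgue_on \<Omega>) powr (1 / p)"

definition locally_integrable ::
  "'a::euclidean_space set \<Rightarrow> ('a \<Rightarrow> 'b::euclidean_space) \<Rightarrow> bool" where
  "locally_integrable \<Omega> g \<longleftrightarrow> (\<forall>K. compact K \<and> K \<subseteq> \<Omega> \<longrightarrow> integrable (lebesgue_on K) g)"

definition has_weak_gradient ::
  "'a::euclidean_space set \<Rightarrow> ('a \<Rightarrow> real) \<Rightarrow> ('a \<Rightarrow> 'a) \<Rightarrow> bool" where
  "has_weak_gradient \<Omega> u g \<longleftrightarrow> locally_integrable \<Omega> u \<and> locally_integrable \<Omega> g \<and>
    (\<forall>\<phi>\<in>test_functions \<Omega>.
      (\<integral>x. u x *\<^sub>R grad \<phi> x \<partial>lebesgue_on \<Omega>) = - (\<integral>x. \<phi> x *\<^sub>R g x \<partial>lebesgue_on \<Omega>))"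

text \<open>
  The weak gradient is unique up to null sets (on open \<open>\<Omega>\<close>); \<open>weak_grad\<close> picks one representative,
  and every notion below is invariant under changing it on a null set.
\<close>

definition weak_grad ::
  "'a::euclidean_space set \<Rightarrow> ('a \<Rightarrow> real) \<Rightarrow> 'a \<Rightarrow> 'a" where
  "weak_grad \<Omega> u = (SOME g. has_weak_gradient \<Omega> u g)"

definition W1p :: "real \<Rightarrow> 'a::euclidean_space set \<Rightarrow> ('a \<Rightarrow> real) set" where
  "W1p p \<Omega> =
    {u \<in> Lp_space p \<Omega>. (\<exists>g. has_weak_gradient \<Omega> u g) \<and> weak_grad \<Omega> u \<in> Lp_space p \<Omega>}"

text \<open>The closure of the test functions in the Sobolev norm.\<close>

definition W1p_0 :: "real \<Rightarrow> 'a::euclidean_space set \<Rightarrow> ('a \<Rightarrow> real) set" where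
  "W1p_0 p \<Omega> = {u \<in> W1p p \<Omega>. \<exists>\<phi>.
    (\<forall>n::nat. \<phi> n \<in> test_functions \<Omega>) \<and>
    (\<lambda>n. Lp_norm p \<Omega> (\<lambda>x. \<phi> n x - u x)) \<longlonglongrightarrow> 0 \<and>
    (\<lambda>n. Lp_norm p \<Omega> (\<lambda>x. grad (\<phi> n) x - weak_grad \<Omega> u x)) \<longlonglongrightarrow> 0}"

section \<open>The Dirichlet problem\<close>

definition H :: "real \<Rightarrow> 'a::euclidean_space \<Rightarrow> 'a" where
  "H \<alpha> \<xi> = (if \<xi> = 0 then 0 else (max 0 (norm \<xi> - 1) powr \<alpha>) *\<^sub>R (\<xi> /\<^sub>R norm \<xi>))"

text \<open>
  Integrability of \<open>f \<phi>\<close> is required explicitly because the Bochner integral of a non-integrable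
  function is 0.  The integrand on the left is always integrable, since
  \<open>\<bar>H (p - 1) \<xi>\<bar> \<le> \<bar>\<xi>\<bar> powr (p - 1)\<close>.
\<close>

definition weak_solution ::
  "real \<Rightarrow> real \<Rightarrow> ('a::euclidean_space \<Rightarrow> real) \<Rightarrow> ('a \<Rightarrow> real) \<Rightarrow> bool" where
  "weak_solution p R f u \<longleftrightarrow> u \<in> W1p_0 p (ball 0 R) \<and>
    (\<forall>\<phi>\<in>test_functions (ball 0 R).
      integrable (lebesgue_on (ball 0 R)) (\<lambda>x. f x * \<phi> x) \<and>
      (\<integral>x. H (p - 1) (weak_grad (ball 0 R) u x) \<bullet> grad \<phi> x \<partial>lebesgue_on (ball 0 R)) =
      (\<integral>x. f x * \<phi> x \<partial>lebesgue_on (ball 0 R)))"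

section \<open>Rearrangements and Lorentz spaces\<close>

definition distr_fun ::
  "'a::euclidean_space set \<Rightarrow> ('a \<Rightarrow> real) \<Rightarrow> real \<Rightarrow> ennreal" where
  "distr_fun \<Omega> f \<tau> = emeasure (lebesgue_on \<Omega>) {x \<in> \<Omega>. \<tau> < \<bar>f x\<bar>}"

text \<open>
  Extended values are used because \<open>f\<^sup>*(0) = inf {} = \<infinity>\<close> for essentially unbounded \<open>f\<close>, and
  because \<open>f\<^sup>*\<^sup>*\<close> may be infinite.
\<close>

definition decr_rearr ::
  "'a::euclidean_space set \<Rightarrow> ('a \<Rightarrow> real) \<Rightarrow> real \<Rightarrow> ennreal" where
  "decr_rearr \<Omega> f l = (INF \<tau>\<in>{\<tau>. 0 \<le> \<tau> \<and> distr_fun \<Omega> f \<tau> \<le> ennreal l}. ennreal \<tau>)"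

definition max_rearr ::
  "'a::euclidean_space set \<Rightarrow> ('a \<Rightarrow> real) \<Rightarrow> real \<Rightarrow> ennreal" where
  "max_rearr \<Omega> f t = (\<integral>\<^sup>+s\<in>{0..t}. decr_rearr \<Omega> f s \<partial>lborel) / ennreal t"

definition weak_Lorentz_norm ::
  "real \<Rightarrow> 'a::euclidean_space set \<Rightarrow> ('a \<Rightarrow> real) \<Rightarrow> ennreal" where
  "weak_Lorentz_norm r \<Omega> f = (SUP t\<in>{0<..}. ennreal (t powr (1 / r)) * max_rearr \<Omega> f t)"

definition weak_Lorentz :: "real \<Rightarrow> 'a::euclidean_space set \<Rightarrow> ('a \<Rightarrow> real) set" where
  "weak_Lorentz r \<Omega> =
    {f \<in> borel_measurable (lebesgue_on \<Omega>). weak_Lorentz_norm r \<Omega> f < \<infinity>}"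

text \<open>
  The origin is left out: a real-valued \<open>f\<close> that is non-increasing in \<open>\<bar>x\<bar>\<close> down to \<open>x = 0\<close> would be
  bounded by \<open>f 0\<close>, which excludes singular data such as \<open>\<bar>x\<bar> powr (- a)\<close>.
\<close>

definition radially_decreasing :: "real \<Rightarrow> ('a::euclidean_space \<Rightarrow> real) \<Rightarrow> bool" where
  "radially_decreasing R f \<longleftrightarrow>
    (\<exists>h. antimono_on {0<..<R} h \<and> (\<forall>x\<in>ball 0 R - {0}. f x = h (norm x)))"

end

theory Submission
  imports Defs
begin

text \<open>
  The radial problem is solved explicitly by a function with gradient
  \<open>g = - (1 + F powr (1 / (p - 1))) x / \<bar>x\<bar>\<close>, where
  \<open>F(x) = \<bar>x\<bar> \<integral>\<^sub>0\<^sup>1 s\<^sup>N\<^sup>-\<^sup>1 f(s x) ds\<close>, and \<open>H g = - F x / \<bar>x\<bar>\<close>.  The difference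
  \<open>D = H (\<nabla>u) - H g\<close> is divergence free.  Testing with radial functions shows that \<open>D\<close> is
  orthogonal to all radial fields; with truncations of powers of \<open>F\<close> this gives \<open>F \<in> L\<^sup>p\<^sup>'\<close>, so that
  \<open>\<nabla>u\<close> itself becomes admissible and \<open>\<integral> D \<bullet> (\<nabla>u - g) = 0\<close>.  As \<open>H\<close> is monotone, strictly in the
  norm beyond 1, \<open>\<bar>\<nabla>u\<bar> \<le> \<bar>g\<bar>\<close> almost everywhere.  Finally \<open>f \<in> L\<^sup>r\<^sup>,\<^sup>\<infinity>\<close> means \<open>f \<le> C \<bar>x\<bar>\<^sup>-\<^sup>N\<^sup>/\<^sup>r\<close>,
  hence \<open>F \<le> C' \<bar>x\<bar>\<^sup>1\<^sup>-\<^sup>N\<^sup>/\<^sup>r\<close>.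
\<close>

section \<open>Test functions\<close>

text \<open>No symmetry of \<open>u\<close> is assumed, and the operator vanishes on gradients of
  norm at most 1, so \<open>u\<close> cannot be identified with the radial solution. What survives
  is a one-sided comparison of gradient norms, and both claims need no more. The obstacle is
  integrability: pairing D with \<nabla>u requires D in L^p', but the Lorentz bound F \<le> B
  |x|^(1-N/r) only makes F integrable. The existence of a weak solution repairs this: H(\<nabla>u)
  lies in L^p' because |H(\<xi>)| \<le> |\<xi>|^(p-1), and testing with radial fields bounds the
  L^p' norm of F by that of H(\<nabla>u). The range in (i) then comes from |\<nabla>u| \<le> 1 +
  F^(1/(p-1)): the weight |x|^(-(N/r-1)/(p-1)) has an integrable q-th power near the origin exactly
  for q < Nr(p-1)/(N-r). Polar coordinates are avoided; dilations, dyadic balls and image measures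
  under the norm take their place.\<close>

definition flat :: "nat \<Rightarrow> real \<Rightarrow> real" where
  "flat n t = (if t \<le> 0 then 0 else exp (- (1 / t)) / t ^ n)"

lemma flat_nonneg: "0 \<le> flat n t"
  by (simp add: flat_def)

text \<open>A single term of the exponential series at 1/t, that of index n+k, already gives the
  bound. It serves with k = 2 for the derivative at 0 and with k = 0 for boundedness.\<close>

lemma flat_bound:
  assumes "t > 0"
  shows "flat n t \<le> fact (n + k) * t ^ k"
proof -
  have "inverse (fact (n + k)) * (1 / t) ^ (n + k) \<le> exp (1 / t)"
    unfolding exp_def using sum_le_suminf[OF summable_exp, of "{n + k}" "1 / t"] assms
    by (simp add: scaleR_conv_of_real)
  then have "exp (- (1 / t)) \<le> fact (n + k) * t ^ (n + k)"
    using assms by (simp add: exp_minus field_simps)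
  then show ?thesis
    using assms by (simp add: flat_def divide_le_eq power_add mult_ac)
qed

text \<open>Differentiating exp(-1/t)/t^n only shifts the power of 1/t. Carrying that power in the
  index closes the family under derivatives up to linear combinations.\<close>

lemma flat_has_derivative:
  "(flat n has_real_derivative (flat (n + 2) t - real n * flat (n + 1) t)) (at t)"
proof -
  consider "t < 0" | "t = 0" | "t > 0" by linarith
  then show ?thesis
  proof cases
    case 1
    have "((\<lambda>_. 0) has_real_derivative 0) (at t)" by simp
    then have "(flat n has_real_derivative 0) (at t)"
      by (rule has_field_derivative_transform_within_open[where S="{..<0}"])
         (use 1 in \<open>auto simp: flat_def\<close>)
    with 1 show ?thesis by (simp add: flat_def)
  next
    case 3
    have "((\<lambda>s. exp (- (1 / s)) / s ^ n) has_real_derivative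
        (exp (- (1 / t)) / t ^ (n + 2) - real n * (exp (- (1 / t)) / t ^ (n + 1)))) (at t)"
    proof (rule DERIV_cong)
      have "((\<lambda>s. exp (- (1 / s))) has_real_derivative exp (- (1 / t)) / t\<^sup>2) (at t)"
        using 3 by (auto intro!: derivative_eq_intros simp: power2_eq_square)
      moreover have "((\<lambda>s. s ^ n) has_real_derivative real n * t ^ (n - 1)) (at t)"
        using DERIV_pow[of n t] by simp
      ultimately show "((\<lambda>s. exp (- (1 / s)) / s ^ n) has_real_derivative
          (exp (- (1 / t)) / t\<^sup>2 * t ^ n - exp (- (1 / t)) * (real n * t ^ (n - 1))) / (t ^ n * t ^ n)) (at t)"
        using 3 by (intro DERIV_divide) auto
      have "real n * t ^ (n - 1) = real n * t ^ n / t"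
        using 3 by (cases n) auto
      then show "(exp (- (1 / t)) / t\<^sup>2 * t ^ n - exp (- (1 / t)) * (real n * t ^ (n - 1))) / (t ^ n * t ^ n)
          = exp (- (1 / t)) / t ^ (n + 2) - real n * (exp (- (1 / t)) / t ^ (n + 1))"
        using 3 by (simp only:) (simp add: field_simps power2_eq_square)
    qed
    then have "(flat n has_real_derivative
        (exp (- (1 / t)) / t ^ (n + 2) - real n * (exp (- (1 / t)) / t ^ (n + 1)))) (at t)"
      by (rule has_field_derivative_transform_within_open[where S="{0<..}"])
         (use 3 in \<open>auto simp: flat_def\<close>)
    with 3 show ?thesis by (simp add: flat_def)
  next
    case 2
    \<comment> \<open>A quadratic bound from the right, and the value 0 from the left, make the
      difference quotient at most a multiple of |h|.\<close>
    have "((\<lambda>h. flat n h / h) \<longlongrightarrow> 0) (at 0)"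
    proof (rule Lim_null_comparison)
      show "\<forall>\<^sub>F h in at 0. norm (flat n h / h) \<le> fact (n + 2) * \<bar>h\<bar>"
      proof (rule always_eventually, rule allI)
        fix h :: real
        show "norm (flat n h / h) \<le> fact (n + 2) * \<bar>h\<bar>"
        proof (cases "h > 0")
          case True
          with flat_bound[OF True, of n 2] flat_nonneg[of n h] show ?thesis
            by (simp add: divide_le_eq power2_eq_square mult_ac)
        qed (auto simp: flat_def mult_nonneg_nonpos simp del: fact_Suc add_2_eq_Suc')
      qed
      show "((\<lambda>h. fact (n + 2) * \<bar>h\<bar>) \<longlongrightarrow> 0) (at (0::real))"
        by (auto intro!: tendsto_eq_intros)
    qed
    with 2 show ?thesis by (simp add: DERIV_def flat_def)
  qed
qed

lemma flat_continuous [continuous_intros]: "continuous_on A (flat n)"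
  by (meson DERIV_isCont continuous_at_imp_continuous_on flat_has_derivative)

text \<open>\<open>smooth\<close> asks for differentiability of all iterated directional
  derivatives. A syntactic class closed under directional derivatives reduces this to one induction
  on the list of directions.\<close>

inductive elementary_smooth :: "('a::euclidean_space \<Rightarrow> real) \<Rightarrow> bool" where
  const: "elementary_smooth (\<lambda>_. c)"
| inner: "elementary_smooth (\<lambda>x. x \<bullet> v)"
| add: "elementary_smooth \<phi> \<Longrightarrow> elementary_smooth \<psi> \<Longrightarrow> elementary_smooth (\<lambda>x. \<phi> x + \<psi> x)"
| mult: "elementary_smooth \<phi> \<Longrightarrow> elementary_smooth \<psi> \<Longrightarrow> elementary_smooth (\<lambda>x. \<phi> x * \<psi> x)"
| flat: "elementary_smooth \<phi> \<Longrightarrow> elementary_smooth (\<lambda>x. flat n (\<phi> x))"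

lemma elementary_smooth_sum:
  "finite I \<Longrightarrow> (\<And>i. i \<in> I \<Longrightarrow> elementary_smooth (\<phi> i)) \<Longrightarrow> elementary_smooth (\<lambda>x. \<Sum>i\<in>I. \<phi> i x)"
  by (induction I rule: finite_induct) (auto intro: elementary_smooth.intros)

lemma elementary_smooth_has_derivative:
  "elementary_smooth \<phi> \<Longrightarrow>
     \<exists>\<phi>'. \<forall>v. elementary_smooth (\<phi>' v) \<and> (\<forall>x. (\<phi> has_derivative (\<lambda>v. \<phi>' v x)) (at x))"
proof (induction rule: elementary_smooth.induct)
  case (const c)
  show ?case
    by (intro exI[of _ "\<lambda>_ _. 0"]) (auto intro: elementary_smooth.const)
next
  case (inner v)
  show ?case
    by (intro exI[of _ "\<lambda>w _. w \<bullet> v"])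
       (auto intro: elementary_smooth.const derivative_eq_intros)
next
  case (add \<phi> \<psi>)
  then obtain \<phi>' \<psi>' where "\<forall>v. elementary_smooth (\<phi>' v) \<and> (\<forall>x. (\<phi> has_derivative (\<lambda>v. \<phi>' v x)) (at x))"
    "\<forall>v. elementary_smooth (\<psi>' v) \<and> (\<forall>x. (\<psi> has_derivative (\<lambda>v. \<psi>' v x)) (at x))"
    by blast
  then show ?case
    by (intro exI[of _ "\<lambda>v x. \<phi>' v x + \<psi>' v x"])
       (auto intro: elementary_smooth.add has_derivative_add)
next
  case (mult \<phi> \<psi>)
  then obtain \<phi>' \<psi>' where "\<forall>v. elementary_smooth (\<phi>' v) \<and> (\<forall>x. (\<phi> has_derivative (\<lambda>v. \<phi>' v x)) (at x))"
    "\<forall>v. elementary_smooth (\<psi>' v) \<and> (\<forall>x. (\<psi> has_derivative (\<lambda>v. \<psi>' v x)) (at x))"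
    by blast
  with mult show ?case
    by (intro exI[of _ "\<lambda>v x. \<phi> x * \<psi>' v x + \<phi>' v x * \<psi> x"])
       (auto intro!: elementary_smooth.add elementary_smooth.mult has_derivative_mult)
next
  case (flat \<phi> n)
  then obtain \<phi>' where \<phi>': "\<forall>v. elementary_smooth (\<phi>' v) \<and> (\<forall>x. (\<phi> has_derivative (\<lambda>v. \<phi>' v x)) (at x))"
    by blast
  have "((\<lambda>x. flat n (\<phi> x)) has_derivative
      (\<lambda>v. (flat (n + 2) (\<phi> x) + (- real n) * flat (n + 1) (\<phi> x)) * \<phi>' v x)) (at x)" for x
    using has_derivative_compose[OF \<phi>'[rule_format, THEN conjunct2, rule_format]
        flat_has_derivative[of n "\<phi> x", unfolded has_field_derivative_def]]
    by simp
  then show ?case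
    using \<phi>' flat.hyps
    by (intro exI[of _ "\<lambda>v x. (flat (n + 2) (\<phi> x) + (- real n) * flat (n + 1) (\<phi> x)) * \<phi>' v x"])
       (intro allI conjI elementary_smooth.intros; blast)
qed

lemma elementary_smooth_imp_smooth:
  assumes "elementary_smooth \<phi>"
  shows "smooth \<phi>"
proof -
  have "elementary_smooth (iter_dir_deriv vs \<phi>)" for vs
  proof (induction vs)
    case (Cons v vs)
    then obtain \<phi>' where \<phi>': "\<forall>v. elementary_smooth (\<phi>' v) \<and>
        (\<forall>x. (iter_dir_deriv vs \<phi> has_derivative (\<lambda>v. \<phi>' v x)) (at x))"
      using elementary_smooth_has_derivative by blast
    then have "iter_dir_deriv (v # vs) \<phi> = \<phi>' v"
      using frechet_derivative_at[OF \<phi>'[rule_format, THEN conjunct2, rule_format]]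
      by (simp add: fun_eq_iff)
    with \<phi>' show ?case by simp
  qed (use assms in simp)
  then show ?thesis
    unfolding smooth_def differentiable_def using elementary_smooth_has_derivative by blast
qed

section \<open>Gradients of smooth functions and of test functions\<close>

lemma grad_eqI:
  assumes "(\<phi> has_derivative (\<lambda>v. g \<bullet> v)) (at x)"
  shows "grad \<phi> x = g"
proof -
  have "frechet_derivative \<phi> (at x) b = g \<bullet> b" for b
    by (simp add: frechet_derivative_at[OF assms, symmetric])
  then show ?thesis by (simp add: grad_def euclidean_representation)
qed

lemma smooth_has_derivative:
  assumes "smooth \<phi>"
  shows "(\<phi> has_derivative (\<lambda>v. grad \<phi> x \<bullet> v)) (at x)"
proof -
  have d: "(\<phi> has_derivative frechet_derivative \<phi> (at x)) (at x)"
    using assms[unfolded smooth_def, rule_format, of "[]"] by (simp add: frechet_derivative_works)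
  interpret linear "frechet_derivative \<phi> (at x)"
    using d by (rule has_derivative_linear)
  have "frechet_derivative \<phi> (at x) v = grad \<phi> x \<bullet> v" for v
  proof -
    have "frechet_derivative \<phi> (at x) v = frechet_derivative \<phi> (at x) (\<Sum>b\<in>Basis. (v \<bullet> b) *\<^sub>R b)"
      by (simp add: euclidean_representation)
    also have "\<dots> = grad \<phi> x \<bullet> v"
      by (simp add: sum scale grad_def inner_sum_right inner_commute[of _ v] mult.commute)
    finally show ?thesis .
  qed
  with d show ?thesis by (metis (no_types, lifting) ext)
qed

lemma smooth_continuous_on_grad:
  assumes "smooth \<phi>"
  shows "continuous_on A (grad \<phi>)"
proof -
  have "continuous_on A (iter_dir_deriv [b] \<phi>)" for b
    using assms unfolding smooth_def
    by (meson continuous_at_imp_continuous_on differentiable_imp_continuous_within)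
  then show ?thesis
    unfolding grad_def[abs_def] by (auto intro!: continuous_intros)
qed

lemma smooth_continuous_on:
  assumes "smooth \<phi>"
  shows "continuous_on A \<phi>"
  using smooth_has_derivative[OF assms]
  by (meson continuous_at_imp_continuous_on has_derivative_continuous)

lemma test_functionE:
  assumes "\<phi> \<in> test_functions \<Omega>"
  obtains C where "C \<ge> 0" "\<And>x. norm (grad \<phi> x) \<le> C"
    "\<And>x. x \<notin> \<Omega> \<Longrightarrow> grad \<phi> x = 0" "\<And>x. x \<notin> \<Omega> \<Longrightarrow> \<phi> x = 0"
proof -
  define S where "S = closure {x. \<phi> x \<noteq> 0}"
  have S: "smooth \<phi>" "compact S" "S \<subseteq> \<Omega>"
    using assms by (auto simp: test_functions_def S_def)
  have \<phi>0: "\<phi> x = 0" if "x \<notin> S" for x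
    using that closure_subset[of "{x. \<phi> x \<noteq> 0}"] by (auto simp: S_def)
  have g0: "grad \<phi> x = 0" if "x \<notin> S" for x
  proof (rule grad_eqI)
    show "(\<phi> has_derivative (\<lambda>v. 0 \<bullet> v)) (at x)"
      by (rule has_derivative_transform_within_open[where f="\<lambda>_. 0" and s="- S"])
         (use that \<phi>0 S in \<open>auto simp: compact_imp_closed open_Compl\<close>)
  qed
  obtain C1 where C1: "\<forall>x\<in>S. norm (grad \<phi> x) \<le> C1"
    using compact_imp_bounded[OF compact_continuous_image[OF smooth_continuous_on_grad[OF S(1)] S(2)]]
    by (auto simp: bounded_iff)
  show ?thesis
  proof
    show "norm (grad \<phi> x) \<le> max 0 C1" for x
      using C1 g0 by (cases "x \<in> S") (simp_all add: le_max_iff_disj)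
  qed (use g0 \<phi>0 S in auto)
qed

text \<open>
  The function \<open>s exp(-1/s)\<close> has a bounded derivative tending to 1 at infinity, so the
  gradients below converge boundedly to \<open>-2x\<close> on the ball of radius \<open>t\<close> and to 0 outside.
\<close>

definition cutoff :: "real \<Rightarrow> nat \<Rightarrow> 'a::euclidean_space \<Rightarrow> real" where
  "cutoff t k x = (let s = real (Suc k) * (t\<^sup>2 - x \<bullet> x) - 1 in s * flat 0 s / real (Suc k))"

definition cutoff_slope :: "real \<Rightarrow> nat \<Rightarrow> 'a::euclidean_space \<Rightarrow> real" where
  "cutoff_slope t k x =
    (let s = real (Suc k) * (t\<^sup>2 - x \<bullet> x) - 1 in flat 0 s + flat 1 s)"

lemma elementary_smooth_cutoff: "elementary_smooth (cutoff t k :: 'a::euclidean_space \<Rightarrow> real)"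
proof -
  have sq: "elementary_smooth (\<lambda>x::'a. x \<bullet> x)"
    by (subst euclidean_inner)
       (auto intro!: elementary_smooth_sum elementary_smooth.mult elementary_smooth.inner)
  define s where "s = (\<lambda>x::'a. (real (Suc k) * t\<^sup>2 - 1) + (- real (Suc k)) * (x \<bullet> x))"
  have s: "elementary_smooth s"
    unfolding s_def
    by (intro elementary_smooth.add elementary_smooth.mult elementary_smooth.const sq)
  have "cutoff t k = (\<lambda>x. (inverse (real (Suc k)) * s x) * flat 0 (s x))"
    by (auto simp: cutoff_def s_def Let_def field_simps)
  with s show ?thesis
    by (auto intro!: elementary_smooth.intros)
qed

lemma grad_cutoff: "grad (cutoff t k) x = (- 2 * cutoff_slope t k x) *\<^sub>R x"
proof (rule grad_eqI)
  define s where "s = (\<lambda>x::'a. real (Suc k) * (t\<^sup>2 - x \<bullet> x) - 1)"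
  have s: "(s has_derivative (\<lambda>v. - 2 * real (Suc k) * (x \<bullet> v))) (at x)"
    unfolding s_def by (auto intro!: derivative_eq_intros simp: inner_commute algebra_simps)
  have f: "((\<lambda>x. flat 0 (s x)) has_derivative
      (\<lambda>v. flat 2 (s x) * (- 2 * real (Suc k) * (x \<bullet> v)))) (at x)"
    using has_derivative_compose[OF s flat_has_derivative[of 0 "s x", unfolded has_field_derivative_def]]
    by (simp add: numeral_2_eq_2)
  \<comment> \<open>This brings the derivative of s exp(-1/s) into the form of
    \<open>cutoff_slope\<close>. For s \<le> 0 both sides vanish.\<close>
  have eq: "s x * flat 2 (s x) = flat 1 (s x)"
    by (simp add: flat_def power2_eq_square)
  have "((\<lambda>x. s x * flat 0 (s x) / real (Suc k)) has_derivative
      (\<lambda>v. (s x * (flat 2 (s x) * (- 2 * real (Suc k) * (x \<bullet> v)))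
         + (- 2 * real (Suc k) * (x \<bullet> v)) * flat 0 (s x)) / real (Suc k))) (at x)"
    by (intro bounded_linear.has_derivative[OF bounded_linear_divide] has_derivative_mult s f)
  also have "(\<lambda>v. (s x * (flat 2 (s x) * (- 2 * real (Suc k) * (x \<bullet> v)))
         + (- 2 * real (Suc k) * (x \<bullet> v)) * flat 0 (s x)) / real (Suc k))
     = (\<lambda>v. ((- 2 * (flat 0 (s x) + s x * flat 2 (s x))) *\<^sub>R x) \<bullet> v)"
    by (simp del: of_nat_Suc add: fun_eq_iff inner_diff_left) (simp del: of_nat_Suc add: field_simps)
  finally show "(cutoff t k has_derivative (\<lambda>v. ((- 2 * cutoff_slope t k x) *\<^sub>R x) \<bullet> v)) (at x)"
    unfolding eq unfolding cutoff_def[abs_def] cutoff_slope_def Let_def s_def .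
qed

text \<open>The shift by 1 in s pushes the support into |x|^2 \<le> t^2 - 1/(k+1), strictly inside
  the ball of radius t; hence t = R is allowed. Where the radicand is negative, so is its root, and
  the closed ball is empty.\<close>

lemma cutoff_test_function:
  assumes "0 < t" "t \<le> R"
  shows "cutoff t k \<in> test_functions (ball (0::'a::euclidean_space) R)"
proof -
  define \<rho> where "\<rho> = sqrt (t\<^sup>2 - 1 / real (Suc k))"
  have sub: "{x::'a. cutoff t k x \<noteq> 0} \<subseteq> cball 0 \<rho>"
  proof
    fix x :: 'a assume "x \<in> {x. cutoff t k x \<noteq> 0}"
    then have "real (Suc k) * (t\<^sup>2 - x \<bullet> x) > 1"
      by (auto simp: cutoff_def flat_def Let_def split: if_splits)
    then have "(norm x)\<^sup>2 \<le> t\<^sup>2 - 1 / real (Suc k)"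
      by (simp add: power2_norm_eq_inner field_simps)
    then show "x \<in> cball 0 \<rho>"
      by (simp add: \<rho>_def real_le_rsqrt)
  qed
  have "\<rho> < t"
    unfolding \<rho>_def using assms by (intro real_less_lsqrt) auto
  then have "cball (0::'a) \<rho> \<subseteq> ball 0 R"
    using assms by auto
  moreover have "closure {x::'a. cutoff t k x \<noteq> 0} \<subseteq> cball 0 \<rho>"
    using closure_minimal[OF sub closed_cball] .
  ultimately show ?thesis
    unfolding test_functions_def
    using elementary_smooth_imp_smooth[OF elementary_smooth_cutoff[of t k]]
    by (auto simp: compact_closure intro: bounded_subset[OF bounded_cball sub])
qed

lemma cutoff_slope_bound: "\<bar>cutoff_slope t k x\<bar> \<le> 2"
proof -
  have "flat 0 s + flat 1 s \<le> 2" for s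
  proof (cases "s > 0")
    case True
    have "flat 1 s \<le> 1" using flat_bound[OF True, of 1 0] by simp
    moreover have "flat 0 s \<le> 1" using flat_bound[OF True, of 0 0] by simp
    ultimately show ?thesis by simp
  qed (simp add: flat_def)
  then show ?thesis
    using flat_nonneg by (auto simp: cutoff_slope_def Let_def abs_of_nonneg)
qed

lemma cutoff_slope_tendsto:
  assumes "0 < t"
  shows "(\<lambda>k. cutoff_slope t k x) \<longlonglongrightarrow> indicator (ball 0 t) x"
proof (cases "norm x < t")
  case True
  then have pos: "t\<^sup>2 - x \<bullet> x > 0"
    using power_strict_mono[OF True, of 2] by (simp add: power2_norm_eq_inner)
  define s where "s = (\<lambda>k. real (Suc k) * (t\<^sup>2 - x \<bullet> x) - 1)"
  have "filterlim (\<lambda>k. real (Suc k)) at_top sequentially"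
    by (rule filterlim_compose[OF filterlim_real_sequentially filterlim_Suc])
  then have "filterlim (\<lambda>k. real (Suc k) * (t\<^sup>2 - x \<bullet> x)) at_top sequentially"
    by (rule filterlim_at_top_mult_tendsto_pos[OF tendsto_const pos])
  then have s: "filterlim s at_top sequentially"
    unfolding s_def using filterlim_tendsto_add_at_top[OF tendsto_const[of "-1"]]
    by (simp add: add.commute)
  have inv: "(\<lambda>k. 1 / s k) \<longlonglongrightarrow> 0"
    using tendsto_inverse_0_at_top[OF s] by (simp add: inverse_eq_divide)
  have "(\<lambda>k. exp (- (1 / s k)) + exp (- (1 / s k)) * (1 / s k)) \<longlonglongrightarrow> exp (- 0) + exp (- 0) * 0"
    by (intro tendsto_intros inv)
  moreover have "\<forall>\<^sub>F k in sequentially. exp (- (1 / s k)) + exp (- (1 / s k)) * (1 / s k) = cutoff_slope t k x"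
    using filterlim_at_top_dense[THEN iffD1, OF s, rule_format, of 0]
    by eventually_elim (simp add: cutoff_slope_def flat_def Let_def s_def)
  ultimately have "(\<lambda>k. cutoff_slope t k x) \<longlonglongrightarrow> exp (- 0) + exp (- 0) * 0"
    by (rule Lim_transform_eventually)
  with True show ?thesis by simp
next
  case False
  then have "t\<^sup>2 \<le> x \<bullet> x"
    using power_mono[of t "norm x" 2] assms by (simp add: power2_norm_eq_inner)
  then have "real (Suc k) * (t\<^sup>2 - x \<bullet> x) \<le> 0" for k
    by (intro mult_nonneg_nonpos) auto
  then have "real (Suc k) * (t\<^sup>2 - x \<bullet> x) - 1 \<le> 0" for k
    by (meson diff_le_0_iff_le order_trans zero_le_one)
  then have "cutoff_slope t k x = 0" for k
    unfolding cutoff_slope_def flat_def Let_def by simp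
  with False show ?thesis by simp
qed

section \<open>Integration\<close>

text \<open>Dyadic summation: for R/2^(k+1) \<le> |x| < R/2^k the integrand is at most 2^|b|
  (R/2^k)^(-b). Each shell may be enlarged to the full ball, since the volumes still give a
  geometric series of ratio 2^(b-N) < 1. The absolute value covers negative b; at the origin
  \<open>0 powr (- b)\<close> is 0.\<close>

lemma integrable_norm_powr_ball:
  assumes "b < real DIM('a::euclidean_space)"
  shows "integrable lborel (\<lambda>x::'a. indicator (ball 0 R) x * norm x powr (- b))"
proof (cases "R > 0")
  case False
  then have "(\<lambda>x::'a. indicator (ball 0 R) x * norm x powr (- b)) = (\<lambda>_. 0)"
    by (simp add: ball_empty)
  then show ?thesis by simp
next
  case R: True
  define N where "N = DIM('a)"
  define \<rho> where "\<rho> k = R * (1/2) ^ k" for k :: nat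
  define \<omega> where "\<omega> = measure lborel (ball (0::'a) 1)"
  define T where "T k x = ennreal (2 powr \<bar>b\<bar> * \<rho> k powr (- b)) * indicator (ball 0 (\<rho> k)) x"
    for k and x :: 'a
  have \<rho>: "\<rho> k > 0" for k using R by (simp add: \<rho>_def)
  have bound: "ennreal (indicator (ball 0 R) x * norm x powr (- b)) \<le> (\<Sum>k. T k x)" for x :: 'a
  proof (cases "x \<noteq> 0 \<and> norm x < R")
    case True
    have "(\<lambda>k. \<rho> (Suc k)) \<longlonglongrightarrow> R * 0"
      unfolding \<rho>_def by (intro tendsto_intros LIMSEQ_Suc LIMSEQ_realpow_zero) auto
    then have "\<exists>k. \<rho> (Suc k) \<le> norm x"
      using order_tendstoD(2)[of _ "0::real" sequentially "norm x"] True
      by (fastforce simp: eventually_sequentially intro: less_imp_le)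
    then obtain k where k: "\<rho> (Suc k) \<le> norm x" "\<And>j. j < k \<Longrightarrow> \<not> \<rho> (Suc j) \<le> norm x"
      using exists_least_iff[of "\<lambda>k. \<rho> (Suc k) \<le> norm x"] by blast
    have lt: "norm x < \<rho> k"
      using k(2)[of "k - 1"] True by (cases k) (auto simp: \<rho>_def)
    define s where "s = norm x / \<rho> k"
    have s: "1/2 \<le> s" "s < 1"
      using k(1) lt \<rho>[of k] by (auto simp: s_def field_simps \<rho>_def)
    have "s powr (- b) \<le> 2 powr \<bar>b\<bar>"
    proof (cases "b \<ge> 0")
      case True
      have "s powr (- b) \<le> (1/2) powr (- b)"
        using s True by (intro powr_mono2') auto
      also have "\<dots> = 2 powr \<bar>b\<bar>"
        using True by (simp add: powr_minus powr_divide)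
      finally show ?thesis .
    next
      case False
      have "s powr (- b) \<le> 1 powr (- b)"
        using s False by (intro powr_mono2) auto
      also have "\<dots> \<le> 2 powr \<bar>b\<bar>"
        by (simp add: ge_one_powr_ge_zero)
      finally show ?thesis .
    qed
    then have "norm x powr (- b) \<le> 2 powr \<bar>b\<bar> * \<rho> k powr (- b)"
    proof -
      have "norm x powr (- b) = s powr (- b) * \<rho> k powr (- b)"
        using \<rho>[of k] by (simp add: s_def powr_mult [symmetric])
      then show ?thesis
        using \<open>s powr (- b) \<le> 2 powr \<bar>b\<bar>\<close> by (simp add: mult_right_mono)
    qed
    then have "ennreal (indicator (ball 0 R) x * norm x powr (- b)) \<le> T k x"
      using lt True by (simp add: T_def ennreal_leI)
    also have "\<dots> \<le> (\<Sum>k. T k x)"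
      using sum_le_suminf[of "\<lambda>k. T k x" "{k}"] by simp
    finally show ?thesis .
  qed (auto simp: indicator_def)
  have Tm: "T k \<in> borel_measurable lborel" for k
    unfolding T_def[abs_def]
    by (intro borel_measurable_times_ennreal borel_measurable_const borel_measurable_indicator) simp
  have emb: "emeasure lborel (ball (0::'a) (\<rho> k)) = ennreal (\<rho> k ^ N * \<omega>)" for k
    using content_ball_conv_unit_ball[of "\<rho> k" "0::'a"] \<rho>[of k]
      emeasure_eq_ennreal_measure[of lborel "ball (0::'a) (\<rho> k)"] emeasure_lborel_ball_finite[of "0::'a" "\<rho> k"]
    by (simp add: \<omega>_def N_def)
  have "(\<integral>\<^sup>+x. ennreal (indicator (ball 0 R) x * norm x powr (- b)) \<partial>(lborel :: 'a measure))
      \<le> (\<integral>\<^sup>+x. (\<Sum>k. T k x) \<partial>lborel)"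
    by (intro nn_integral_mono bound)
  also have "\<dots> = (\<Sum>k. \<integral>\<^sup>+x. T k x \<partial>lborel)"
    by (rule nn_integral_suminf) (rule Tm)
  also have "\<dots> = (\<Sum>k. ennreal (2 powr \<bar>b\<bar> * \<omega> * R powr (real N - b) * ((1/2) powr (real N - b)) ^ k))"
  proof (intro suminf_cong)
    fix k
    have "(\<integral>\<^sup>+x. T k x \<partial>lborel) = ennreal (2 powr \<bar>b\<bar> * \<rho> k powr (- b)) * ennreal (\<rho> k ^ N * \<omega>)"
      unfolding T_def by (subst nn_integral_cmult_indicator) (auto simp: emb)
    also have "\<dots> = ennreal (2 powr \<bar>b\<bar> * \<omega> * (\<rho> k powr (- b) * \<rho> k powr real N))"
      using \<rho>[of k] by (simp add: ennreal_mult'' [symmetric] \<omega>_def powr_realpow mult_ac)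
    also have "\<rho> k powr (- b) * \<rho> k powr real N = \<rho> k powr (real N - b)"
      by (simp add: powr_add [symmetric])
    also have "\<dots> = R powr (real N - b) * ((1/2) powr (real N - b)) ^ k"
    proof -
      have "((1/2::real) ^ k) powr (real N - b) = ((1/2) powr (real N - b)) ^ k"
        by (simp only: powr_powr powr_realpow [symmetric] powr_power mult.commute zero_less_divide_1_iff
            zero_less_numeral)
      then show ?thesis
        using R by (simp add: \<rho>_def powr_mult)
    qed
    finally show "(\<integral>\<^sup>+x. T k x \<partial>lborel) =
        ennreal (2 powr \<bar>b\<bar> * \<omega> * R powr (real N - b) * ((1/2) powr (real N - b)) ^ k)"
      by (simp add: mult_ac)
  qed
  also have "\<dots> < \<infinity>"
  proof -
    have "(1/2::real) powr (real N - b) < 1"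
      using assms powr_less_mono2[of "real N - b" "1/2" 1] by (simp add: N_def)
    then have "summable (\<lambda>k. 2 powr \<bar>b\<bar> * \<omega> * R powr (real N - b) * ((1/2) powr (real N - b)) ^ k)"
      by (intro summable_mult summable_geometric) auto
    then show ?thesis
      by (subst suminf_ennreal2) (auto simp: \<omega>_def)
  qed
  finally show ?thesis
    by (intro integrableI_bounded borel_measurable_times borel_measurable_indicator) auto
qed

lemma integral_lborel_scaleR:
  fixes g :: "'a::euclidean_space \<Rightarrow> real"
  assumes [measurable]: "g \<in> borel_measurable borel" and "c > 0"
  shows "(\<integral>x. g x \<partial>lborel) = c ^ DIM('a) * (\<integral>x. g (c *\<^sub>R x) \<partial>lborel)"
proof -
  have "(\<integral>x. g x \<partial>lborel) = (\<integral>x. g x \<partial>density (distr lborel borel (\<lambda>x::'a. 0 + c *\<^sub>R x)) (\<lambda>_. ennreal (\<bar>c\<bar> ^ DIM('a))))"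
    using \<open>c > 0\<close> by (subst lborel_affine[of c "0::'a"]) auto
  also have "\<dots> = (\<integral>x. c ^ DIM('a) * g (c *\<^sub>R x) \<partial>lborel)"
    using \<open>c > 0\<close> by (simp add: integral_density integral_distr)
  finally show ?thesis by simp
qed

text \<open>
  The measures with densities \<open>d\<^sup>+\<close> and \<open>d\<^sup>-\<close> have the same image under \<open>N\<close>.
\<close>

lemma integral_compose_eq_0:
  fixes d N :: "'b \<Rightarrow> real" and \<gamma> :: "real \<Rightarrow> real"
  assumes d: "integrable M d" and N[measurable]: "N \<in> borel_measurable M"
    and \<gamma>[measurable]: "\<gamma> \<in> borel_measurable borel" and nonneg: "\<And>t. 0 \<le> \<gamma> t"
    and zero: "\<And>t. (\<integral>x. indicator {..<t} (N x) * d x \<partial>M) = 0"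
    and int: "integrable M (\<lambda>x. \<gamma> (N x) * d x)"
  shows "(\<integral>x. \<gamma> (N x) * d x \<partial>M) = 0"
proof -
  have dm[measurable]: "d \<in> borel_measurable M" using d by auto
  \<comment> \<open>\<open>ennreal\<close> sends negative reals to 0, so e = 1 and e = -1 give the
    positive and the negative part of d by one formula.\<close>
  define \<mu> where "\<mu> e = distr (density M (\<lambda>x. ennreal (e * d x))) borel N" for e :: real
  have em: "emeasure (\<mu> e) A = (\<integral>\<^sup>+x. ennreal (e * (indicator A (N x) * d x)) \<partial>M)"
    if [measurable]: "A \<in> sets borel" for e A
    unfolding \<mu>_def
    by (subst emeasure_distr, simp, simp, subst emeasure_density, measurable)
       (auto intro!: nn_integral_cong simp: indicator_def)
  have fin: "emeasure (\<mu> e) A < \<infinity>" if A[measurable]: "A \<in> sets borel" for e A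
  proof -
    have "integrable M (\<lambda>x. e * (indicator A (N x) * d x))"
      by (intro integrable_mult_right Bochner_Integration.integrable_bound[OF d])
         (auto simp: indicator_def)
    then have "(\<integral>\<^sup>+x. norm (e * (indicator A (N x) * d x)) \<partial>M) < \<infinity>"
      unfolding integrable_iff_bounded by blast
    then show ?thesis
      unfolding em[OF A]
      by (elim le_less_trans[rotated]) (auto intro!: nn_integral_mono ennreal_leI)
  qed
  \<comment> \<open>Open half-lines form an intersection-stable generator, and on each of them the
    two finite values differ by an integral that is zero by hypothesis.\<close>
  have "\<mu> 1 = \<mu> (- 1)"
  proof (rule measure_eqI_generator_eq[where E="range lessThan" and \<Omega>=UNIV and A="\<lambda>i. {..<real i}"])
    show "Int_stable (range (lessThan :: real \<Rightarrow> _))"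
    proof (rule Int_stableI)
      fix a b :: "real set" assume "a \<in> range lessThan" "b \<in> range lessThan"
      then obtain s t where "a = {..<s}" "b = {..<t}" by auto
      then have "a \<inter> b = {..<min s t}" by auto
      then show "a \<inter> b \<in> range lessThan" by blast
    qed
    show "(\<Union>i. {..<real i}) = UNIV"
      by (auto intro: reals_Archimedean2)
    show "emeasure (\<mu> 1) {..<real i} \<noteq> \<infinity>" for i
      using fin[of "{..<real i}" 1] by simp
    show "sets (\<mu> 1) = sigma_sets UNIV (range lessThan)" "sets (\<mu> (-1)) = sigma_sets UNIV (range lessThan)"
      unfolding \<mu>_def by (simp_all add: borel_Iio sets_measure_of)
    fix X :: "real set" assume "X \<in> range lessThan"
    then obtain t where X: "X = {..<t}" by auto
    have i: "integrable M (\<lambda>x. indicator {..<t} (N x) * d x)"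
      by (rule Bochner_Integration.integrable_bound[OF d]) (auto simp: indicator_def)
    have "0 = enn2real (emeasure (\<mu> 1) X) - enn2real (emeasure (\<mu> (- 1)) X)"
      using real_lebesgue_integral_def[OF i] zero[of t] by (simp add: em X)
    then show "emeasure (\<mu> 1) X = emeasure (\<mu> (- 1)) X"
      using fin[of X 1] fin[of X "- 1"] X
      by (metis ennreal_enn2real eq_iff_diff_eq_0 infinity_ennreal_def lessThan_borel)
  qed (auto intro: rangeI)
  moreover have "(\<integral>\<^sup>+t. ennreal (\<gamma> t) \<partial>\<mu> e) = (\<integral>\<^sup>+x. ennreal (e * (\<gamma> (N x) * d x)) \<partial>M)" for e
    unfolding \<mu>_def
    by (subst nn_integral_distr, simp, simp, subst nn_integral_density)
       (auto intro!: nn_integral_cong simp: nonneg ennreal_mult'[symmetric] ennreal_mult''[symmetric] mult_ac)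
  ultimately have "(\<integral>\<^sup>+x. ennreal (1 * (\<gamma> (N x) * d x)) \<partial>M) = (\<integral>\<^sup>+x. ennreal ((-1) * (\<gamma> (N x) * d x)) \<partial>M)"
    by metis
  then show ?thesis
    by (simp add: real_lebesgue_integral_def[OF int])
qed

section \<open>Young's inequality and the pairing of L^p with its dual\<close>

lemma norm_diff_powr_le:
  fixes a b :: "'b::real_normed_vector"
  assumes "p > 0"
  shows "norm (a - b) powr p \<le> 2 powr p * (norm a powr p + norm b powr p)"
proof -
  \<comment> \<open>Passing through the maximum, instead of convexity, also covers exponents below
    1.\<close>
  have "norm (a - b) \<le> 2 * max (norm a) (norm b)"
    using norm_triangle_ineq4[of a b] by (auto simp: max_def)
  then have "norm (a - b) powr p \<le> (2 * max (norm a) (norm b)) powr p"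
    using assms by (intro powr_mono2) auto
  also have "\<dots> = 2 powr p * max (norm a) (norm b) powr p"
    by (simp add: powr_mult)
  also have "max (norm a) (norm b) powr p \<le> norm a powr p + norm b powr p"
    by (auto simp: max_def)
  finally show ?thesis by simp
qed

lemma integrable_norm_diff_powr:
  fixes a b :: "'b \<Rightarrow> 'c::euclidean_space"
  assumes "p > 0" and [measurable]: "a \<in> borel_measurable M" "b \<in> borel_measurable M"
    and "integrable M (\<lambda>x. norm (a x) powr p)" "integrable M (\<lambda>x. norm (b x) powr p)"
  shows "integrable M (\<lambda>x. norm (a x - b x) powr p)"
  by (rule Bochner_Integration.integrable_bound
      [where f="\<lambda>x. 2 powr p * (norm (a x) powr p + norm (b x) powr p)"])
     (use assms norm_diff_powr_le[OF assms(1)] in \<open>auto intro!: AE_I2\<close>)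

text \<open>Young's inequality for s a and b/s with s = \<epsilon>^(1/q), the factors 1/q and 1/p
  being dropped. The weight serves twice: a fixed \<epsilon> absorbs a term, and \<epsilon>
  \<rightarrow> 0 makes one negligible.\<close>

lemma weighted_Young_inequality:
  fixes a b :: real
  assumes "p > 1" "\<epsilon> > 0" "a \<ge> 0" "b \<ge> 0"
  shows "a * b \<le> \<epsilon> * a powr (p / (p - 1)) + \<epsilon> powr (1 - p) * b powr p"
proof -
  define q where "q = p / (p - 1)"
  define s where "s = \<epsilon> powr (1 / q)"
  have q: "q > 1" "1 / q + 1 / p = 1" "q > 0"
    using assms by (auto simp: q_def field_simps)
  have s: "s > 0" using assms by (simp add: s_def)
  have e: "1 / q * p = p - 1"
    using assms by (simp add: q_def)
  have "a * b = (s * a) * (b / s)"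
    using s by simp
  also have "\<dots> \<le> (s * a) powr q / q + (b / s) powr p / p"
    using s assms q by (intro Youngs_inequality) auto
  also have "\<dots> \<le> (s * a) powr q + (b / s) powr p"
    using q assms by (intro add_mono) (auto simp: divide_le_eq mult_le_cancel_left1)
  also have "(s * a) powr q = \<epsilon> * a powr q"
    using q assms s by (simp add: powr_mult s_def powr_powr)
  also have "(b / s) powr p = \<epsilon> powr (1 - p) * b powr p"
  proof -
    have "s powr p = \<epsilon> powr (p - 1)"
      by (simp only: s_def powr_powr e)
    then show ?thesis
      using s powr_minus_divide[of \<epsilon> "p - 1"] by (simp add: powr_divide)
  qed
  finally show ?thesis by (simp add: q_def)
qed

lemma integrable_norm_mult:
  fixes D w :: "'b \<Rightarrow> 'c::euclidean_space"
  assumes "p > 1" and [measurable]: "D \<in> borel_measurable M" "w \<in> borel_measurable M"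
    and D: "integrable M (\<lambda>x. norm (D x) powr (p / (p - 1)))"
    and w: "integrable M (\<lambda>x. norm (w x) powr p)"
  shows "integrable M (\<lambda>x. norm (D x) * norm (w x))"
  by (rule Bochner_Integration.integrable_bound[OF Bochner_Integration.integrable_add[OF D w]])
     (use weighted_Young_inequality[OF \<open>p > 1\<close>, of 1] in \<open>auto intro!: AE_I2\<close>)

lemma integrable_inner:
  fixes D w :: "'b \<Rightarrow> 'c::euclidean_space"
  assumes "p > 1" and [measurable]: "D \<in> borel_measurable M" "w \<in> borel_measurable M"
    and D: "integrable M (\<lambda>x. norm (D x) powr (p / (p - 1)))"
    and w: "integrable M (\<lambda>x. norm (w x) powr p)"
  shows "integrable M (\<lambda>x. D x \<bullet> w x)"
  by (rule Bochner_Integration.integrable_bound[OF integrable_norm_mult[OF assms]])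
     (auto simp: Cauchy_Schwarz_ineq2)

text \<open>Up to sign, the integral is the pairing of D with the error \<open>w - g n\<close>.
  Young's inequality bounds it by \<epsilon> A plus a multiple of the L^p error; the limit in n is
  taken first, then \<epsilon> \<rightarrow> 0.\<close>

lemma integral_inner_eq_0_closure:
  fixes D w :: "'b \<Rightarrow> 'c::euclidean_space"
  assumes p: "p > 1"
    and meas[measurable]: "D \<in> borel_measurable M" "w \<in> borel_measurable M"
      "\<And>n. g n \<in> borel_measurable M"
    and D: "integrable M (\<lambda>x. norm (D x) powr (p / (p - 1)))"
    and w: "integrable M (\<lambda>x. norm (w x) powr p)"
    and g: "\<And>n. integrable M (\<lambda>x. norm (g n x) powr p)"
    and zero: "\<And>n. (\<integral>x. D x \<bullet> g n x \<partial>M) = 0"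
    and lim: "(\<lambda>n. \<integral>x. norm (g n x - w x) powr p \<partial>M) \<longlonglongrightarrow> 0"
  shows "(\<integral>x. D x \<bullet> w x \<partial>M) = 0"
proof -
  define I where "I = (\<integral>x. D x \<bullet> w x \<partial>M)"
  define A where "A = (\<integral>x. norm (D x) powr (p / (p - 1)) \<partial>M)"
  have diff: "integrable M (\<lambda>x. norm (g n x - w x) powr p)" for n
    using p by (intro integrable_norm_diff_powr g w) auto
  have le: "\<bar>I\<bar> \<le> \<epsilon> * A + \<epsilon> powr (1 - p) * (\<integral>x. norm (g n x - w x) powr p \<partial>M)"
    if "\<epsilon> > 0" for \<epsilon> n
  proof -
    have "\<bar>I\<bar> = \<bar>\<integral>x. D x \<bullet> (g n x - w x) \<partial>M\<bar>"
      unfolding I_def inner_diff_right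
      by (subst Bochner_Integration.integral_diff)
         (use zero[of n] in \<open>auto intro!: integrable_inner[OF p] D w g\<close>)
    also have "\<dots> \<le> (\<integral>x. \<epsilon> * norm (D x) powr (p / (p - 1))
        + \<epsilon> powr (1 - p) * norm (g n x - w x) powr p \<partial>M)"
    proof (rule integral_abs_bound[THEN order_trans], rule integral_mono)
      show "integrable M (\<lambda>x. \<bar>D x \<bullet> (g n x - w x)\<bar>)"
        by (intro integrable_abs integrable_inner[OF p] D diff) auto
      show "\<bar>D x \<bullet> (g n x - w x)\<bar> \<le> \<epsilon> * norm (D x) powr (p / (p - 1))
        + \<epsilon> powr (1 - p) * norm (g n x - w x) powr p" for x
        using Cauchy_Schwarz_ineq2[of "D x" "g n x - w x"]
          weighted_Young_inequality[OF p that, of "norm (D x)" "norm (g n x - w x)", OF norm_ge_zero norm_ge_zero] by linarith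
    qed (intro Bochner_Integration.integrable_add integrable_mult_right D diff)
    also have "\<dots> = \<epsilon> * A + \<epsilon> powr (1 - p) * (\<integral>x. norm (g n x - w x) powr p \<partial>M)"
      unfolding A_def by (subst Bochner_Integration.integral_add) (auto intro!: D diff)
    finally show ?thesis .
  qed
  have "\<bar>I\<bar> \<le> \<epsilon> * A" if "\<epsilon> > 0" for \<epsilon>
  proof (rule LIMSEQ_le_const)
    show "(\<lambda>n. \<epsilon> * A + \<epsilon> powr (1 - p) * (\<integral>x. norm (g n x - w x) powr p \<partial>M)) \<longlonglongrightarrow> \<epsilon> * A"
      using tendsto_add[OF tendsto_const[of "\<epsilon> * A"] tendsto_mult[OF tendsto_const[of "\<epsilon> powr (1 - p)"] lim]]
      by simp
  qed (use le[OF that] in blast)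
  then have "\<forall>\<^sub>F \<epsilon> in at_right 0. \<bar>I\<bar> \<le> \<epsilon> * A"
    by (auto simp: eventually_at_right_less intro: eventually_mono[OF eventually_at_right_less])
  moreover have "((\<lambda>\<epsilon>. \<epsilon> * A) \<longlongrightarrow> 0) (at_right 0)"
    by (auto intro!: tendsto_eq_intros)
  ultimately have "\<bar>I\<bar> \<le> 0"
    by (intro tendsto_lowerbound) auto
  then show ?thesis by (simp add: I_def)
qed

section \<open>Pointwise bound for radial functions in weak Lorentz spaces\<close>

text \<open>By monotonicity |f| is at least h(t) on the punctured ball of radius t, whose volume is
  V = \<omega> t^N. Hence the decreasing rearrangement is at least h(t) below V, and so is its
  average up to V; the Lorentz norm therefore bounds V^(1/r) h(t).\<close>

lemma radial_weak_Lorentz_bound: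
  fixes f :: "'a::euclidean_space \<Rightarrow> real"
  assumes r: "r > 0" and f: "f \<in> weak_Lorentz r (ball 0 R)"
    and anti: "antimono_on {0<..<R} h"
    and fh: "\<And>x. x \<in> ball 0 R - {0} \<Longrightarrow> f x = h (norm x)"
    and nonneg: "\<And>t. 0 < t \<Longrightarrow> t < R \<Longrightarrow> 0 \<le> h t"
  obtains C where "C \<ge> 0" "\<And>t. 0 < t \<Longrightarrow> t < R \<Longrightarrow> h t \<le> C * t powr (- (real DIM('a) / r))"
proof -
  define N where "N = DIM('a)"
  define \<omega> where "\<omega> = measure lborel (ball (0::'a) 1)"
  have \<omega>: "\<omega> > 0" unfolding \<omega>_def by (rule content_ball_pos) simp
  define L where "L = weak_Lorentz_norm r (ball 0 R) f"
  have L: "L < \<infinity>" and [measurable]: "f \<in> borel_measurable (lebesgue_on (ball 0 R))"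
    using f by (auto simp: weak_Lorentz_def L_def)
  have main: "h t \<le> (enn2real L * \<omega> powr (- (1 / r))) * t powr (- (real N / r))" if t: "0 < t" "t < R" for t
  proof -
    define V where "V = t ^ N * \<omega>"
    have V: "V > 0" using t \<omega> by (simp add: V_def)
    have ball: "emeasure (lebesgue_on (ball 0 R)) (ball (0::'a) t - {0}) = ennreal V"
    proof -
      have "emeasure (lebesgue_on (ball 0 R)) (ball (0::'a) t - {0}) = emeasure lborel (ball (0::'a) t - {0})"
        using t by (subst emeasure_restrict_space) auto
      also have "\<dots> = emeasure lborel (ball (0::'a) t)"
        by (intro emeasure_Diff_null_set) auto
      also have "\<dots> = ennreal V"
        using content_ball_conv_unit_ball[of t "0::'a"] t
          emeasure_eq_ennreal_measure[of lborel "ball (0::'a) t"] emeasure_lborel_ball_finite[of "0::'a" t]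
        by (simp add: \<omega>_def N_def V_def)
      finally show ?thesis .
    qed
    \<comment> \<open>A level \<tau> < h(t) has a superlevel set containing the punctured ball, so
      of measure at least V; the strict inequality s < V yields the contradiction.\<close>
    have rearr: "ennreal (h t) \<le> decr_rearr (ball 0 R) f s" if s: "0 \<le> s" "s < V" for s
      unfolding decr_rearr_def
    proof (rule INF_greatest, safe)
      fix \<tau> assume \<tau>: "0 \<le> \<tau>" "distr_fun (ball 0 R) f \<tau> \<le> ennreal s"
      show "ennreal (h t) \<le> ennreal \<tau>"
      proof (rule ccontr)
        assume "\<not> ennreal (h t) \<le> ennreal \<tau>"
        then have lt: "\<tau> < h t" by (meson ennreal_leI not_le)
        have "\<tau> < \<bar>f x\<bar>" if x: "x \<in> ball 0 t - {0}" for x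
        proof -
          have "h t \<le> h (norm x)"
            using anti x t by (auto simp: monotone_on_def)
          with x t lt show ?thesis by (auto simp: fh)
        qed
        then have sub: "ball 0 t - {0} \<subseteq> {x \<in> ball 0 R. \<tau> < \<bar>f x\<bar>}"
          using t by auto
        have m: "{x \<in> ball 0 R. \<tau> < \<bar>f x\<bar>} \<in> sets (lebesgue_on (ball 0 R))"
          using borel_measurable_less[of "\<lambda>_. \<tau>" "lebesgue_on (ball 0 R)" "\<lambda>x. \<bar>f x\<bar>"]
          by simp
        have "ennreal V \<le> distr_fun (ball 0 R) f \<tau>"
          unfolding distr_fun_def ball[symmetric] by (rule emeasure_mono[OF sub m])
        also have "\<dots> \<le> ennreal s" by (rule \<tau>)
        finally show False using s by (simp add: ennreal_le_iff)
      qed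
    qed
    have "ennreal (h t) * ennreal V = (\<integral>\<^sup>+s. ennreal (h t) * indicator {0..<V} s \<partial>lborel)"
      using V by (subst nn_integral_cmult_indicator) auto
    also have "\<dots> \<le> (\<integral>\<^sup>+s\<in>{0..V}. decr_rearr (ball 0 R) f s \<partial>lborel)"
      by (intro nn_integral_mono) (auto simp: indicator_def rearr)
    finally have "ennreal (h t) * ennreal V / ennreal V \<le> max_rearr (ball 0 R) f V"
      unfolding max_rearr_def by (rule divide_right_mono_ennreal)
    then have "ennreal (h t) \<le> max_rearr (ball 0 R) f V"
      using V by (simp add: ennreal_times_divide [symmetric] ennreal_divide_self)
    then have "ennreal (V powr (1 / r)) * ennreal (h t) \<le> ennreal (V powr (1 / r)) * max_rearr (ball 0 R) f V"
      by (rule mult_left_mono) simp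
    also have "\<dots> \<le> L"
      unfolding L_def weak_Lorentz_norm_def using V by (intro SUP_upper) auto
    also have "L = ennreal (enn2real L)" using L by simp
    finally have "V powr (1 / r) * h t \<le> enn2real L"
      by (simp add: ennreal_mult'[symmetric] ennreal_le_iff)
    then have "h t \<le> enn2real L * V powr (- (1 / r))"
      using V by (simp add: powr_minus field_simps)
    also have "V powr (- (1 / r)) = \<omega> powr (- (1 / r)) * t powr (- (real N / r))"
      using t \<omega> by (simp add: V_def powr_mult powr_powr powr_realpow[symmetric])
    finally show ?thesis by (simp add: mult_ac)
  qed
  show ?thesis
    by (rule that[of "enn2real L * \<omega> powr (- (1 / r))"]) (use main in \<open>auto simp: N_def\<close>)
qed

section \<open>A vector field with prescribed divergence\<close>

lemma integrable_lborel_product: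
  fixes A :: "'a::euclidean_space \<Rightarrow> real" and B :: "'b::euclidean_space \<Rightarrow> real"
  assumes A: "integrable lborel A" and B: "integrable lborel B"
  shows "integrable (lborel \<Otimes>\<^sub>M lborel) (\<lambda>(x, y). A x * B y)"
proof -
  have [measurable]: "A \<in> borel_measurable borel" "B \<in> borel_measurable borel"
    using assms by auto
  show ?thesis
    by (rule lborel_pair.Fubini_integrable) (use A B in \<open>auto simp: abs_mult\<close>)
qed

lemma integrable_powr_Ioc:
  assumes "- 1 < e"
  shows "integrable lborel (\<lambda>s::real. indicator {0<..1} s * s powr e)"
  by (rule Bochner_Integration.integrable_bound[OF integrable_norm_powr_ball[of "- e" 2, where 'a=real]])
     (use assms in \<open>auto simp: indicator_def\<close>)

text \<open>For f = h(|.|) the substitution \<tau> = s |y| gives |y|^(-N) times the integral of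
  \<tau>^(N-1) h(\<tau>) over ]0,|y|], which is 1/N times the mean of f over the ball of radius
  |y|.\<close>

definition ray_average :: "('a::euclidean_space \<Rightarrow> real) \<Rightarrow> 'a \<Rightarrow> real" where
  "ray_average f y = (\<integral>s. indicator {0<..1} s * (s ^ (DIM('a) - 1) * f (s *\<^sub>R y)) \<partial>lborel)"

text \<open>The bound on f at s y splits into a power of s and a power of |y|; the former, with the
  weight s^(N-1), is integrable because a < N.\<close>

lemma ray_average_bound:
  fixes f :: "'a::euclidean_space \<Rightarrow> real"
  assumes a: "a < real DIM('a)" and f: "\<And>x. x \<noteq> 0 \<Longrightarrow> \<bar>f x\<bar> \<le> C * norm x powr (- a)" and "y \<noteq> 0"
  shows "\<bar>ray_average f y\<bar> \<le>
    C * (\<integral>s. indicator {0<..1} s * s powr (real DIM('a) - 1 - a) \<partial>lborel) * norm y powr (- a)"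
proof -
  let ?w = "\<lambda>s. indicator {0<..1} s * s powr (real DIM('a) - 1 - a)"
  have "\<bar>ray_average f y\<bar> \<le> (\<integral>s. (C * norm y powr (- a)) * ?w s \<partial>lborel)"
    unfolding ray_average_def
  proof (rule integral_abs_bound[THEN order_trans], rule integral_mono')
    show "integrable lborel (\<lambda>s. (C * norm y powr (- a)) * ?w s)"
      using a by (intro integrable_mult_right integrable_powr_Ioc) auto
    show "\<bar>indicator {0<..1} s * (s ^ (DIM('a) - 1) * f (s *\<^sub>R y))\<bar> \<le> (C * norm y powr (- a)) * ?w s" for s
    proof (cases "s \<in> {0<..1}")
      case True
      have "s ^ (DIM('a) - 1) * \<bar>f (s *\<^sub>R y)\<bar> \<le> s ^ (DIM('a) - 1) * (C * norm (s *\<^sub>R y) powr (- a))"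
        using True \<open>y \<noteq> 0\<close> by (intro mult_left_mono f) auto
      also have "\<dots> = C * norm y powr (- a) * (s powr (real (DIM('a) - 1)) * s powr (- a))"
        using True by (simp add: powr_mult powr_realpow del: of_nat_diff)
      also have "s powr (real (DIM('a) - 1)) * s powr (- a) = s powr (real DIM('a) - 1 - a)"
        by (simp add: powr_add [symmetric] of_nat_diff)
      finally show ?thesis using True by (simp add: abs_mult)
    qed simp
    have "0 \<le> C * norm y powr (- a)"
      using f[OF \<open>y \<noteq> 0\<close>] by linarith
    then show "0 \<le> (C * norm y powr (- a)) * ?w s" for s by simp
  qed
  also have "\<dots> = C * integral\<^sup>L lborel ?w * norm y powr (- a)"
    unfolding Bochner_Integration.integral_mult_right_zero by (simp only: mult_ac)
  finally show ?thesis .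
qed

lemma borel_measurable_ray_average [measurable]:
  assumes [measurable]: "f \<in> borel_measurable borel"
  shows "ray_average f \<in> borel_measurable borel"
  unfolding ray_average_def[abs_def] by measurable

text \<open>
  Integration of \<open>\<phi>\<close> along rays, \<open>\<phi> z = - \<integral>\<^sub>0\<^sup>1 s\<^sup>-\<^sup>2 z \<bullet> \<nabla>\<phi> (z / s) ds\<close>, followed by the substitution
  \<open>z = s y\<close>, shows that the field \<open>ray_average f y *\<^sub>R y\<close> has divergence \<open>f\<close>.
\<close>

lemma ray_integral_grad:
  fixes \<phi> :: "'a::euclidean_space \<Rightarrow> real"
  assumes \<phi>: "\<phi> \<in> test_functions (ball 0 R)" and z: "z \<noteq> 0" "norm z < R"
  shows "(\<integral>s. indicator {0<..1} s * (z \<bullet> grad \<phi> (z /\<^sub>R s) / s\<^sup>2) \<partial>lborel) = - \<phi> z"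
proof -
  have sm: "smooth \<phi>" using \<phi> by (simp add: test_functions_def)
  obtain C where 0: "\<And>x. x \<notin> ball 0 R \<Longrightarrow> grad \<phi> x = 0" "\<And>x. x \<notin> ball 0 R \<Longrightarrow> \<phi> x = 0"
    using test_functionE[OF \<phi>] by metis
  \<comment> \<open>For s \<le> s0 the point z/s lies outside the ball, where \<phi> and its
    gradient vanish. The singularity of 1/s^2 is thus never met, and the fundamental theorem of
    calculus applies on [s0,1].\<close>
  define s0 where "s0 = norm z / R"
  have R: "R > 0" using z norm_ge_zero[of z] by linarith
  have s0: "0 < s0" "s0 < 1" using z R by (auto simp: s0_def)
  define f where "f s = - (z \<bullet> grad \<phi> (z /\<^sub>R s) / s\<^sup>2)" for s
  have out: "z /\<^sub>R s \<notin> ball 0 R" if "0 < s" "s \<le> s0" for s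
    using that z R by (auto simp: s0_def field_simps)
  have "(\<integral>s. indicator {s0..1} s *\<^sub>R f s \<partial>lborel) = \<phi> (z /\<^sub>R 1) - \<phi> (z /\<^sub>R s0)"
  proof (rule integral_FTC_Icc)
    show "continuous_on {s0..1} f"
      unfolding f_def using s0
      by (intro continuous_intros continuous_on_compose2[OF smooth_continuous_on_grad[OF sm]]) auto
    show "((\<lambda>s. \<phi> (z /\<^sub>R s)) has_vector_derivative f s) (at s within {s0..1})" if "s0 \<le> s" "s \<le> 1" for s
    proof -
      have s: "s > 0" using that s0 by simp
      have "((\<lambda>s. z /\<^sub>R s) has_derivative (\<lambda>h. (- h / s\<^sup>2) *\<^sub>R z)) (at s)"
        using s by (auto intro!: derivative_eq_intros simp: power2_eq_square field_simps)
      from has_derivative_compose[OF this smooth_has_derivative[OF sm]]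
      have "((\<lambda>s. \<phi> (z /\<^sub>R s)) has_derivative (\<lambda>h. h *\<^sub>R f s)) (at s)"
        by (simp add: f_def inner_commute mult_ac)
      then show ?thesis
        by (auto simp: has_vector_derivative_def intro: has_derivative_at_withinI)
    qed
  qed (use s0 in auto)
  also have "(\<lambda>s. indicator {s0..1} s *\<^sub>R f s) = (\<lambda>s. - (indicator {0<..1} s * (z \<bullet> grad \<phi> (z /\<^sub>R s) / s\<^sup>2)))"
    using s0 out 0 by (fastforce simp: fun_eq_iff indicator_def f_def not_le)
  finally show ?thesis
    using 0 out[of s0] s0 by simp
qed

lemma integral_ray_average_grad:
  fixes f \<phi> :: "'a::euclidean_space \<Rightarrow> real"
  assumes [measurable]: "f \<in> borel_measurable borel"
    and a: "a < real DIM('a)" and f: "\<And>x. x \<noteq> 0 \<Longrightarrow> \<bar>f x\<bar> \<le> C * norm x powr (- a)"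
    and supp: "\<And>x. x \<notin> ball 0 R \<Longrightarrow> f x = 0"
    and \<phi>: "\<phi> \<in> test_functions (ball 0 R)"
  shows "(\<integral>y. ray_average f y * (y \<bullet> grad \<phi> y) \<partial>lborel) = - (\<integral>z. f z * \<phi> z \<partial>lborel)"
proof -
  have sm: "smooth \<phi>" using \<phi> by (simp add: test_functions_def)
  have [measurable]: "grad \<phi> \<in> borel_measurable borel" "\<phi> \<in> borel_measurable borel"
    using smooth_continuous_on_grad[OF sm] smooth_continuous_on[OF sm]
    by (auto intro: borel_measurable_continuous_onI)
  obtain C' where C': "C' \<ge> 0" "\<And>x. norm (grad \<phi> x) \<le> C'" "\<And>x. x \<notin> ball 0 R \<Longrightarrow> grad \<phi> x = 0"
    using test_functionE[OF \<phi>] by metis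
  define N where "N = real DIM('a)"
  define I where "I s = (indicator {0<..1} s :: real)" for s :: real
  have [measurable]: "I \<in> borel_measurable borel" unfolding I_def[abs_def] by measurable
  \<comment> \<open>T is the integrand before and U the one after the substitution z = s y. Fubini
    is used on both, so each needs its own integrable majorant of product form.\<close>
  define T where "T s y = I s * (s ^ (DIM('a) - 1) * f (s *\<^sub>R y)) * (y \<bullet> grad \<phi> y)" for s and y :: 'a
  define U where "U s z = I s * (f z * (z \<bullet> grad \<phi> (z /\<^sub>R s)) / s\<^sup>2)" for s and z :: 'a
  \<comment> \<open>The midpoint of ]1, N+1-a[, which is non-empty since a < N: b > 1 makes s^(b-2)
    integrable at 0, and a+b-1 < N makes the remaining power of |z| integrable.\<close>
  define b where "b = 1 + (N - a) / 2"
  have b: "b > 1" "b > 0" "N + (1 - a - b) > 0"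
    using a by (auto simp: b_def N_def field_simps)
  have C: "0 \<le> C" 
  proof -
    obtain e :: 'a where e: "norm e = 1" using vector_choose_size[of 1] by auto
    then have "e \<noteq> 0" by auto
    from f[OF this] e show ?thesis by simp
  qed
  have gC: "\<bar>y \<bullet> grad \<phi> x\<bar> \<le> norm y * C'" for x y
    using Cauchy_Schwarz_ineq2[of y "grad \<phi> x"] mult_left_mono[OF C'(2)[of x] norm_ge_zero[of y]] by linarith
  have T_bound: "norm (T s y) \<le> (I s * s powr (N - 1 - a)) * (C * C' * (indicator (ball 0 R) y * norm y powr (- (a - 1))))" for s y
  proof (cases "s \<in> {0<..1} \<and> y \<in> ball 0 R \<and> y \<noteq> 0")
    case True
    have "norm (T s y) \<le> (s ^ (DIM('a) - 1) * (C * norm (s *\<^sub>R y) powr (- a))) * (norm y * C')"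
    proof -
      have "norm (T s y) = (s ^ (DIM('a) - 1) * \<bar>f (s *\<^sub>R y)\<bar>) * \<bar>y \<bullet> grad \<phi> y\<bar>"
        using True by (simp add: T_def I_def abs_mult)
      also have "\<dots> \<le> (s ^ (DIM('a) - 1) * (C * norm (s *\<^sub>R y) powr (- a))) * (norm y * C')"
        using True C by (intro mult_mono[OF mult_left_mono[OF f] gC]) auto
      finally show ?thesis .
    qed
    also have "\<dots> = C * C' * (s powr (real (DIM('a) - 1)) * s powr (- a)) * (norm y powr (- a) * norm y powr 1)"
      using True by (simp add: powr_mult powr_realpow del: of_nat_diff)
    also have "s powr (real (DIM('a) - 1)) * s powr (- a) = s powr (N - 1 - a)"
      by (simp add: powr_add [symmetric] of_nat_diff N_def)
    also have "norm y powr (- a) * norm y powr 1 = norm y powr (- (a - 1))"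
      by (subst powr_add [symmetric]) (simp add: algebra_simps)
    finally show ?thesis using True by (simp add: I_def mult_ac)
  qed (auto simp: T_def I_def C')
  have T_int: "integrable (lborel \<Otimes>\<^sub>M lborel) (\<lambda>(s, y). T s y)"
  proof (rule Bochner_Integration.integrable_bound[OF integrable_lborel_product])
    show "integrable lborel (\<lambda>s. I s * s powr (N - 1 - a))"
      unfolding I_def using a by (intro integrable_powr_Ioc) (auto simp: N_def)
    show "integrable lborel (\<lambda>y::'a. C * C' * (indicator (ball 0 R) y * norm y powr (- (a - 1))))"
      using a by (intro integrable_mult_right integrable_norm_powr_ball) auto
    show "(\<lambda>(s, y). T s y) \<in> borel_measurable (lborel \<Otimes>\<^sub>M lborel)"
      unfolding T_def by measurable
  qed (use T_bound in \<open>auto intro!: AE_I2 order_trans[OF _ abs_ge_self]\<close>)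
  have U_bound: "norm (U s z) \<le> (I s * s powr (b - 2)) * (C * C' * R powr b * (indicator (ball 0 R) z * norm z powr (- (a + b - 1))))" for s z
  proof (cases "s \<in> {0<..1} \<and> z \<noteq> 0 \<and> z /\<^sub>R s \<in> ball 0 R")
    case True
    then have lt: "norm z < s * R" by (auto simp: field_simps)
    have R: "R > 0" using True le_less_trans[OF norm_ge_zero, of "z /\<^sub>R s" R] by (simp del: norm_scaleR)
    have "s * R \<le> R" using True R by (auto simp: mult_le_cancel_right1)
    with lt have zR: "norm z < R" by linarith
    have "norm (U s z) \<le> (C * norm z powr (- a)) * (norm z * C') / s\<^sup>2"
    proof -
      have "norm (U s z) = \<bar>f z\<bar> * \<bar>z \<bullet> grad \<phi> (z /\<^sub>R s)\<bar> / s\<^sup>2"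
        using True by (simp add: U_def I_def abs_mult)
      also have "\<dots> \<le> (C * norm z powr (- a)) * (norm z * C') / s\<^sup>2"
        using True C by (intro divide_right_mono mult_mono[OF f gC]) auto
      finally show ?thesis .
    qed
    also have "\<dots> = C * C' * (norm z powr (- a) * norm z powr 1) / s\<^sup>2 * 1"
      by simp
    \<comment> \<open>On the support |z| < s R, so the inserted factor is at least 1. It trades
      singularity in s for singularity in z.\<close>
    also have "\<dots> \<le> C * C' * (norm z powr (- a) * norm z powr 1) / s\<^sup>2 * (s * R / norm z) powr b"
      using C C' lt True b R by (intro mult_left_mono ge_one_powr_ge_zero) auto
    also have "\<dots> = C * C' * R powr b * (norm z powr (- a) * norm z powr 1 * norm z powr (- b)) * (s powr b / s powr 2)"
      using True R lt by (simp add: powr_divide powr_mult powr_minus field_simps)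
    also have "norm z powr (- a) * norm z powr 1 * norm z powr (- b) = norm z powr (- (a + b - 1))"
      by (subst powr_add [symmetric])+ (simp add: algebra_simps)
    also have "s powr b / s powr 2 = s powr (b - 2)"
      by (simp add: powr_diff)
    finally show ?thesis using True zR by (simp add: I_def mult_ac)
  next
    case False
    then consider "s \<notin> {0<..1}" | "z = 0" | "grad \<phi> (z /\<^sub>R s) = 0"
      using C'(3) by blast
    then have "U s z = 0" by cases (auto simp: U_def I_def)
    then show ?thesis using C C' by (simp add: I_def)
  qed
  have U_int: "integrable (lborel \<Otimes>\<^sub>M lborel) (\<lambda>(s, y). U s y)"
  proof (rule Bochner_Integration.integrable_bound[OF integrable_lborel_product])
    show "integrable lborel (\<lambda>s. I s * s powr (b - 2))"
      unfolding I_def using b by (intro integrable_powr_Ioc) auto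
    show "integrable lborel (\<lambda>z::'a. C * C' * R powr b * (indicator (ball 0 R) z * norm z powr (- (a + b - 1))))"
      using b by (intro integrable_mult_right integrable_norm_powr_ball) (auto simp: N_def)
    show "(\<lambda>(s, y). U s y) \<in> borel_measurable (lborel \<Otimes>\<^sub>M lborel)"
      unfolding U_def by measurable
  qed (use U_bound in \<open>auto intro!: AE_I2 order_trans[OF _ abs_ge_self]\<close>)
  have TU: "(\<integral>y. T s y \<partial>lborel) = (\<integral>z. U s z \<partial>lborel)" for s
  proof (cases "s \<in> {0<..1}")
    case True
    then have s: "s > 0" by simp
    have "(\<integral>z. U s z \<partial>lborel) = s ^ DIM('a) * (\<integral>y. U s (s *\<^sub>R y) \<partial>lborel)"
      using s by (intro integral_lborel_scaleR) (auto simp: U_def)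
    also have "\<dots> = (\<integral>y. s ^ DIM('a) * U s (s *\<^sub>R y) \<partial>lborel)" by simp
    also have "(\<lambda>y. s ^ DIM('a) * U s (s *\<^sub>R y)) = T s"
    proof
      fix y
      have "s ^ DIM('a) = s * s ^ (DIM('a) - 1)"
        by (subst power_Suc [symmetric]) simp
      then show "s ^ DIM('a) * U s (s *\<^sub>R y) = T s y"
        using s by (simp add: U_def T_def power2_eq_square)
    qed
    finally show ?thesis by simp
  qed (simp add: T_def U_def I_def)
  have "(\<integral>y. ray_average f y * (y \<bullet> grad \<phi> y) \<partial>lborel) = (\<integral>y. (\<integral>s. T s y \<partial>lborel) \<partial>lborel)"
    unfolding T_def I_def ray_average_def by simp
  also have "\<dots> = (\<integral>s. (\<integral>y. T s y \<partial>lborel) \<partial>lborel)"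
    by (rule lborel_pair.Fubini_integral[OF T_int])
  also have "\<dots> = (\<integral>s. (\<integral>z. U s z \<partial>lborel) \<partial>lborel)"
    by (simp add: TU)
  also have "\<dots> = (\<integral>z. (\<integral>s. U s z \<partial>lborel) \<partial>lborel)"
    by (rule lborel_pair.Fubini_integral[OF U_int, symmetric])
  also have "\<dots> = (\<integral>z. - (f z * \<phi> z) \<partial>lborel)"
  proof (rule integral_cong_AE)
    show "(\<lambda>z. \<integral>s. U s z \<partial>lborel) \<in> borel_measurable lborel"
      unfolding U_def by measurable
    show "AE z in lborel. (\<integral>s. U s z \<partial>lborel) = - (f z * \<phi> z)"
      using AE_lborel_singleton[of "0::'a"]
    proof eventually_elim
      fix z :: 'a assume z: "z \<noteq> 0"
      have "(\<lambda>s. U s z) = (\<lambda>s. f z * (indicator {0<..1} s * (z \<bullet> grad \<phi> (z /\<^sub>R s) / s\<^sup>2)))"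
        by (simp add: U_def I_def fun_eq_iff)
      then have "(\<integral>s. U s z \<partial>lborel) = f z * (\<integral>s. indicator {0<..1} s * (z \<bullet> grad \<phi> (z /\<^sub>R s) / s\<^sup>2) \<partial>lborel)"
        by (simp only: Bochner_Integration.integral_mult_right_zero)
      then show "(\<integral>s. U s z \<partial>lborel) = - (f z * \<phi> z)"
        using ray_integral_grad[OF \<phi> z] supp[of z] by (cases "norm z < R") auto
    qed
  qed measurable
  finally show ?thesis by simp
qed

section \<open>Monotonicity of the degenerate operator\<close>

lemma norm_H:
  assumes "\<alpha> > 0"
  shows "norm (H \<alpha> \<xi>) = max 0 (norm \<xi> - 1) powr \<alpha>"
  using assms by (simp add: H_def)

lemma inner_H_self:
  assumes "\<alpha> > 0"
  shows "H \<alpha> \<xi> \<bullet> \<xi> = norm (H \<alpha> \<xi>) * norm \<xi>"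
  using assms by (simp add: norm_H) (simp add: H_def power2_norm_eq_inner[symmetric] power2_eq_square)

text \<open>\<open>H\<close> is a non-negative multiple of its argument, so the diagonal terms are
  exact products of norms and Cauchy-Schwarz is spent on the cross terms only. This reduces
  monotonicity to that of the scalar profile.\<close>

lemma H_mono:
  assumes "\<alpha> > 0"
  shows "(norm (H \<alpha> \<xi>) - norm (H \<alpha> \<eta>)) * (norm \<xi> - norm \<eta>) \<le> (H \<alpha> \<xi> - H \<alpha> \<eta>) \<bullet> (\<xi> - \<eta>)"
proof -
  have "H \<alpha> \<xi> \<bullet> \<eta> \<le> norm (H \<alpha> \<xi>) * norm \<eta>" "H \<alpha> \<eta> \<bullet> \<xi> \<le> norm (H \<alpha> \<eta>) * norm \<xi>"
    by (rule norm_cauchy_schwarz)+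
  then show ?thesis
    by (simp add: inner_diff_left inner_diff_right inner_H_self[OF assms] algebra_simps)
qed

lemma norm_H_mono:
  assumes "\<alpha> > 0" "norm \<eta> \<le> norm \<xi>"
  shows "norm (H \<alpha> \<eta>) \<le> norm (H \<alpha> \<xi>)"
  using assms by (auto simp: norm_H intro!: powr_mono2)

lemma norm_H_strict_mono:
  assumes "\<alpha> > 0" "1 \<le> norm \<eta>" "norm \<eta> < norm \<xi>"
  shows "norm (H \<alpha> \<eta>) < norm (H \<alpha> \<xi>)"
  using assms by (auto simp: norm_H intro!: powr_less_mono2)

lemma H_monotone:
  assumes "\<alpha> > 0"
  shows "0 \<le> (H \<alpha> \<xi> - H \<alpha> \<eta>) \<bullet> (\<xi> - \<eta>)"
proof -
  have "0 \<le> (norm (H \<alpha> \<xi>) - norm (H \<alpha> \<eta>)) * (norm \<xi> - norm \<eta>)"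
    using norm_H_mono[OF assms, of \<xi> \<eta>] norm_H_mono[OF assms, of \<eta> \<xi>]
    by (cases "norm \<xi>" "norm \<eta>" rule: linorder_cases) (auto simp: zero_le_mult_iff)
  with H_mono[OF assms, of \<xi> \<eta>] show ?thesis by linarith
qed

text \<open>The scalar profile is strictly increasing only from 1 on. With \<eta> inside the unit
  ball both values of \<open>H\<close> could vanish without any relation between the norms.\<close>

lemma H_eq_imp_norm_le:
  assumes "\<alpha> > 0" "1 \<le> norm \<eta>" and "(H \<alpha> \<xi> - H \<alpha> \<eta>) \<bullet> (\<xi> - \<eta>) = 0"
  shows "norm \<xi> \<le> norm \<eta>"
proof (rule ccontr)
  assume "\<not> norm \<xi> \<le> norm \<eta>"
  then have "0 < (norm (H \<alpha> \<xi>) - norm (H \<alpha> \<eta>)) * (norm \<xi> - norm \<eta>)"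
    using norm_H_strict_mono[OF assms(1,2), of \<xi>] by auto
  with H_mono[OF assms(1), of \<xi> \<eta>] assms(3) show False by linarith
qed

lemma borel_measurable_H [measurable]: "H \<alpha> \<in> borel_measurable borel"
  unfolding H_def[abs_def] by measurable

text \<open>This places \<open>H\<close> of an L^p gradient in L^p', with p' = p/(p-1).\<close>

lemma norm_H_powr_le:
  assumes "p > 1"
  shows "norm (H (p - 1) \<xi>) powr (p / (p - 1)) \<le> norm \<xi> powr p"
  using assms by (auto simp: norm_H powr_powr intro!: powr_mono2)

text \<open>Solving (s-1)^(p-1) = F gives s = 1 + F^(1/(p-1)). Where F = 0 every vector of the
  closed unit ball is mapped to 0; this choice has norm 1 there, as the strict comparison
  requires.\<close>

lemma H_radial:
  assumes "p > 1" "F \<ge> 0" "x \<noteq> 0"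
  shows "H (p - 1) ((- ((1 + F powr (1 / (p - 1))) / norm x)) *\<^sub>R x) = (- (F / norm x)) *\<^sub>R x"
proof -
  define s where "s = 1 + F powr (1 / (p - 1))"
  have s: "s \<ge> 1" by (simp add: s_def)
  have n: "norm ((- (s / norm x)) *\<^sub>R x) = s"
    using s assms by simp
  then have "(- (s / norm x)) *\<^sub>R x \<noteq> 0"
    using s by (metis norm_zero not_one_le_zero)
  moreover have "max 0 (s - 1) powr (p - 1) = F"
    using assms by (simp add: s_def powr_powr)
  ultimately show ?thesis
    unfolding s_def[symmetric] H_def n using s by simp
qed

section \<open>Comparison with the radial solution\<close>

lemma integrable_lebesgue_on_iff:
  fixes g :: "'a::euclidean_space \<Rightarrow> real"
  assumes "S \<in> sets borel" "g \<in> borel_measurable borel"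
  shows "integrable (lebesgue_on S) g \<longleftrightarrow> integrable lborel (\<lambda>x. indicator S x * g x)"
  using assms by (simp add: integrable_restrict_space integrable_completion)

lemma integral_lebesgue_on_eq:
  fixes g :: "'a::euclidean_space \<Rightarrow> real"
  assumes "S \<in> sets borel" "g \<in> borel_measurable borel"
  shows "integral\<^sup>L (lebesgue_on S) g = (\<integral>x. indicator S x * g x \<partial>lborel)"
  using assms by (simp add: integral_restrict_space integral_completion)

lemma borel_measurable_lebesgue_on:
  "g \<in> borel_measurable borel \<Longrightarrow> g \<in> borel_measurable (lebesgue_on S)"
  by (simp add: measurable_completion measurable_restrict_space1)

lemma AE_lebesgue_on_neq:
  fixes c :: "'a::euclidean_space"
  assumes "S \<in> sets lebesgue"
  shows "AE x in lebesgue_on S. x \<noteq> c"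
  using AE_completion[OF AE_lborel_singleton[of c]] assms
  by (auto simp: AE_restrict_space_iff elim!: eventually_mono)

lemma finite_measure_lebesgue_on_ball: "finite_measure (lebesgue_on (ball (c::'a::euclidean_space) R))"
  by (rule finite_measure_lebesgue_on) simp

text \<open>The exponent a stands for N/r, so a < N expresses r > 1 and a = 1 is the borderline case
  r = N. The profile \<open>h\<close> lives on the whole line and is zero from R on, so that
  integrals over the ball pass to \<open>lborel\<close>.\<close>

locale radial_solution =
  fixes p R C a :: real and f u :: "'a::euclidean_space \<Rightarrow> real" and h :: "real \<Rightarrow> real"
  assumes R: "R > 0" and p: "p > 1" and sol: "weak_solution p R f u"
    and h_meas [measurable]: "h \<in> borel_measurable borel"
    and h_nonneg: "\<And>t. 0 \<le> h t" and h_bound: "\<And>t. 0 < t \<Longrightarrow> h t \<le> C * t powr (- a)"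
    and h_supp: "\<And>t. R \<le> t \<Longrightarrow> h t = 0"
    and a: "a < real DIM('a)"
    and fh: "\<And>x. x \<in> ball 0 R - {0} \<Longrightarrow> f x = h (norm x)"
begin

abbreviation M :: "'a measure" where "M \<equiv> lebesgue_on (ball 0 R)"

lemma AE_M_nonzero: "AE x in M. x \<noteq> 0"
  by (rule AE_lebesgue_on_neq) simp

section \<open>The compared fields and their first integrability properties\<close>

definition w :: "'a \<Rightarrow> 'a" where "w = weak_grad (ball 0 R) u"
definition \<sigma> :: "'a \<Rightarrow> 'a" where "\<sigma> x = H (p - 1) (w x)"
definition \<kappa> :: "real \<Rightarrow> real" where
  "\<kappa> t = (\<integral>s. indicator {0<..1} s * (s ^ (DIM('a) - 1) * h (s * t)) \<partial>lborel)"
definition F :: "'a \<Rightarrow> real" where "F x = norm x * \<kappa> (norm x)"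
text \<open>The second summand is the vector (F/|x|) x written without division, hence minus the
  value of \<open>H\<close> at the radial gradient.\<close>

definition D :: "'a \<Rightarrow> 'a" where "D x = \<sigma> x + \<kappa> (norm x) *\<^sub>R x"
definition q :: real where "q = p / (p - 1)"

lemma q: "q > 1" "q - 1 = 1 / (p - 1)" "(q - 1) * p = q"
  using p by (auto simp: q_def field_simps)

lemma \<kappa>_measurable [measurable]: "\<kappa> \<in> borel_measurable borel"
  unfolding \<kappa>_def[abs_def] by measurable

lemma \<kappa>_nonneg: "0 \<le> \<kappa> t"
  unfolding \<kappa>_def by (rule integral_nonneg_AE) (auto simp: h_nonneg indicator_def)

lemma F_nonneg: "0 \<le> F x"
  by (simp add: F_def \<kappa>_nonneg)

lemma F_measurable [measurable]: "F \<in> borel_measurable borel"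
  unfolding F_def[abs_def] by measurable

lemma \<kappa>_eq_ray_average: "\<kappa> (norm x) = ray_average (\<lambda>x::'a. h (norm x)) x"
  unfolding \<kappa>_def ray_average_def
  by (intro Bochner_Integration.integral_cong) (auto simp: indicator_def)

lemma F_bound: "\<exists>B\<ge>0. \<forall>x. x \<noteq> 0 \<longrightarrow> F x \<le> B * norm x powr (1 - a)"
proof -
  define B where "B = C * (\<integral>s. indicator {0<..1} s * s powr (real DIM('a) - 1 - a) \<partial>lborel)"
  have "h 1 \<le> C" using h_bound[of 1] by simp
  then have "C \<ge> 0" using h_nonneg[of 1] by linarith
  then have "B \<ge> 0"
    unfolding B_def by (intro mult_nonneg_nonneg integral_nonneg_AE) auto
  moreover have "F x \<le> B * norm x powr (1 - a)" if x: "x \<noteq> 0" for x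
  proof -
    have "\<kappa> (norm x) \<le> B * norm x powr (- a)"
      using ray_average_bound[OF a, of "\<lambda>x. h (norm x)" C x] x h_bound h_nonneg \<kappa>_nonneg
      by (simp add: \<kappa>_eq_ray_average[symmetric] B_def)
    then have "F x \<le> norm x powr 1 * (B * norm x powr (- a))"
      unfolding F_def by (simp add: mult_left_mono)
    also have "\<dots> = B * norm x powr (1 - a)"
      by (simp add: powr_diff powr_minus divide_inverse mult_ac)
    finally show ?thesis .
  qed
  ultimately show ?thesis by blast
qed

text \<open>The power in the bound on F is integrable since a - 1 < N. Until \<open>F_Lq\<close>
  this is the integrability available for F, and it suffices for pairing D with bounded
  fields.\<close>

lemma F_integrable: "integrable M F"
proof -
  obtain B where B: "B \<ge> 0" "\<And>x. x \<noteq> 0 \<Longrightarrow> F x \<le> B * norm x powr (1 - a)"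
    using F_bound by blast
  have "integrable M (\<lambda>x. B * norm x powr (- (a - 1)))"
    using integrable_norm_powr_ball[of "a - 1" R, where 'a='a] a
    by (intro integrable_mult_right) (simp add: integrable_lebesgue_on_iff)
  then show ?thesis
  proof (rule Bochner_Integration.integrable_bound)
    show "AE x in M. norm (F x) \<le> norm (B * norm x powr (- (a - 1)))"
    proof (rule AE_I2)
      fix x :: 'a
      show "norm (F x) \<le> norm (B * norm x powr (- (a - 1)))"
        using B F_nonneg[of x] by (cases "x = 0") (auto simp: F_def)
    qed
  qed (simp add: borel_measurable_lebesgue_on)
qed

lemma w_Lp: "w \<in> borel_measurable M" "integrable M (\<lambda>x. norm (w x) powr p)"
  using sol by (auto simp: weak_solution_def W1p_0_def W1p_def Lp_space_def w_def)

lemmas w_measurable [measurable] = w_Lp(1)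

lemma \<sigma>_measurable [measurable]: "\<sigma> \<in> borel_measurable M"
  unfolding \<sigma>_def[abs_def] by measurable

lemma \<sigma>_Lq: "integrable M (\<lambda>x. norm (\<sigma> x) powr q)"
  by (rule Bochner_Integration.integrable_bound[OF w_Lp(2)])
     (use norm_H_powr_le[OF p] in \<open>auto simp: \<sigma>_def q_def\<close>)

lemma radial_measurable [measurable]:
  fixes g :: "real \<Rightarrow> real"
  assumes [measurable]: "g \<in> borel_measurable borel"
  shows "(\<lambda>x. g (norm x)) \<in> borel_measurable M"
  by (rule borel_measurable_lebesgue_on) measurable

lemma id_measurable_M [measurable]: "(\<lambda>x. x) \<in> borel_measurable M"
  by (rule borel_measurable_lebesgue_on) simp

lemma F_measurable_M [measurable]: "F \<in> borel_measurable M"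
  by (rule borel_measurable_lebesgue_on) simp

lemma D_measurable [measurable]: "D \<in> borel_measurable M"
  unfolding D_def[abs_def] by measurable

lemma norm_D_le: "norm (D x) \<le> norm (\<sigma> x) + F x"
  using norm_triangle_ineq[of "\<sigma> x" "\<kappa> (norm x) *\<^sub>R x"] \<kappa>_nonneg[of "norm x"]
  by (simp add: D_def F_def mult.commute)

lemma \<sigma>_integrable: "integrable M (\<lambda>x. norm (\<sigma> x))"
proof -
  interpret finite_measure M by (rule finite_measure_lebesgue_on_ball)
  have "norm (\<sigma> x) \<le> 1 + norm (\<sigma> x) powr q" for x
  proof (cases "norm (\<sigma> x) \<le> 1")
    case False
    then have "norm (\<sigma> x) powr 1 \<le> norm (\<sigma> x) powr q"
      using q(1) by (intro powr_mono) auto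
    with False show ?thesis by simp
  qed (simp add: add_increasing2)
  then show ?thesis
    by (intro Bochner_Integration.integrable_bound[OF Bochner_Integration.integrable_add[OF integrable_const[of 1] \<sigma>_Lq]])
       (auto intro!: AE_I2)
qed

lemma D_integrable: "integrable M (\<lambda>x. norm (D x))"
  by (rule Bochner_Integration.integrable_bound[OF Bochner_Integration.integrable_add[OF \<sigma>_integrable F_integrable]])
     (use norm_D_le F_nonneg in \<open>auto simp: abs_of_nonneg\<close>)

section \<open>Orthogonality of D to test gradients and to radial fields\<close>

lemma D_inner_integrable:
  assumes [measurable]: "v \<in> borel_measurable M" and "\<And>x. norm (v x) \<le> B"
  shows "integrable M (\<lambda>x. D x \<bullet> v x)"
proof (rule Bochner_Integration.integrable_bound[OF integrable_mult_right[OF D_integrable, of B]])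
  show "AE x in M. norm (D x \<bullet> v x) \<le> norm (B * norm (D x))"
  proof (rule AE_I2)
    fix x
    have "norm (D x \<bullet> v x) \<le> norm (D x) * norm (v x)"
      by (simp add: Cauchy_Schwarz_ineq2)
    also have "\<dots> \<le> norm (D x) * B"
      using assms by (intro mult_left_mono) auto
    finally show "norm (D x \<bullet> v x) \<le> norm (B * norm (D x))"
      by (simp add: mult.commute)
  qed
qed measurable

text \<open>Paired with the test gradient, \<sigma> gives the integral of f \<phi> by the weak
  equation, and \<open>\<kappa> (norm x) *\<^sub>R x\<close> gives its negative by the divergence
  identity; the two cancel in D.\<close>

lemma D_grad_eq_0:
  assumes \<phi>: "\<phi> \<in> test_functions (ball 0 R)"
  shows "(\<integral>x. D x \<bullet> grad \<phi> x \<partial>M) = 0"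
proof -
  have sm: "smooth \<phi>" using \<phi> by (simp add: test_functions_def)
  have [measurable]: "grad \<phi> \<in> borel_measurable borel" "\<phi> \<in> borel_measurable borel"
    using smooth_continuous_on_grad[OF sm] smooth_continuous_on[OF sm]
    by (auto intro: borel_measurable_continuous_onI)
  have gM[measurable]: "grad \<phi> \<in> borel_measurable M" by (rule borel_measurable_lebesgue_on) simp
  obtain B where B: "B \<ge> 0" "\<And>x. norm (grad \<phi> x) \<le> B" "\<And>x. x \<notin> ball 0 R \<Longrightarrow> grad \<phi> x = 0"
      "\<And>x. x \<notin> ball 0 R \<Longrightarrow> \<phi> x = 0"
    using test_functionE[OF \<phi>] by metis
  have 1: "integrable M (\<lambda>x. D x \<bullet> grad \<phi> x)"
    by (rule D_inner_integrable[OF gM B(2)])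
  have 2: "integrable M (\<lambda>x. \<kappa> (norm x) * (x \<bullet> grad \<phi> x))"
  proof (rule Bochner_Integration.integrable_bound[OF integrable_mult_right[OF F_integrable, of B]])
    show "AE x in M. norm (\<kappa> (norm x) * (x \<bullet> grad \<phi> x)) \<le> norm (B * F x)"
    proof (rule AE_I2)
      fix x
      have "norm (\<kappa> (norm x) * (x \<bullet> grad \<phi> x)) \<le> \<kappa> (norm x) * (norm x * B)"
        using \<kappa>_nonneg[of "norm x"] Cauchy_Schwarz_ineq2[of x "grad \<phi> x"]
          mult_left_mono[OF B(2)[of x] norm_ge_zero[of x]]
        by (simp add: abs_mult mult_left_mono)
      also have "\<dots> \<le> norm (B * F x)"
        using B(1) \<kappa>_nonneg[of "norm x"] by (simp add: F_def abs_mult mult_ac)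
      finally show "norm (\<kappa> (norm x) * (x \<bullet> grad \<phi> x)) \<le> norm (B * F x)" .
    qed
  qed measurable
  have "(\<integral>x. \<sigma> x \<bullet> grad \<phi> x \<partial>M) = (\<integral>x. f x * \<phi> x \<partial>M)"
    using sol \<phi> by (simp add: weak_solution_def \<sigma>_def w_def)
  \<comment> \<open>Off the origin f agrees with a Borel function, to which the identity on
    \<open>lborel\<close> applies. Measurability of f \<phi> comes from the integrability demanded
    of weak solutions.\<close>
  also have "\<dots> = (\<integral>x. h (norm x) * \<phi> x \<partial>M)"
  proof (rule integral_cong_AE)
    show eq: "AE x in M. f x * \<phi> x = h (norm x) * \<phi> x"
      using AE_M_nonzero AE_space[of M]
      by (auto simp: fh elim: eventually_elim2)
    show "(\<lambda>x. f x * \<phi> x) \<in> borel_measurable M"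
      using sol \<phi> by (auto simp: weak_solution_def)
    show "(\<lambda>x. h (norm x) * \<phi> x) \<in> borel_measurable M"
      by (rule borel_measurable_lebesgue_on) measurable
  qed
  also have "\<dots> = (\<integral>x. h (norm x) * \<phi> x \<partial>lborel)"
    using B(4) by (subst integral_lebesgue_on_eq)
      (auto intro!: Bochner_Integration.integral_cong simp: indicator_def)
  also have "\<dots> = - (\<integral>x. ray_average (\<lambda>x. h (norm x)) x * (x \<bullet> grad \<phi> x) \<partial>lborel)"
    using integral_ray_average_grad[of "\<lambda>x. h (norm x)" a C R \<phi>] a h_bound h_nonneg h_supp \<phi>
    by simp
  also have "\<dots> = - (\<integral>x. \<kappa> (norm x) * (x \<bullet> grad \<phi> x) \<partial>M)"
    using B(3) by (subst integral_lebesgue_on_eq)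
      (auto intro!: Bochner_Integration.integral_cong simp: indicator_def \<kappa>_eq_ray_average)
  finally have eq: "(\<integral>x. \<sigma> x \<bullet> grad \<phi> x \<partial>M) = - (\<integral>x. \<kappa> (norm x) * (x \<bullet> grad \<phi> x) \<partial>M)" .
  have "(\<lambda>x. \<sigma> x \<bullet> grad \<phi> x) = (\<lambda>x. D x \<bullet> grad \<phi> x - \<kappa> (norm x) * (x \<bullet> grad \<phi> x))"
    by (simp add: fun_eq_iff D_def inner_add_left)
  then have "(\<integral>x. \<sigma> x \<bullet> grad \<phi> x \<partial>M) = (\<integral>x. D x \<bullet> grad \<phi> x \<partial>M) - (\<integral>x. \<kappa> (norm x) * (x \<bullet> grad \<phi> x) \<partial>M)"
    using Bochner_Integration.integral_diff[OF 1 2] by simp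
  with eq show ?thesis by simp
qed

lemma D_inner_self_integrable: "integrable M (\<lambda>x. D x \<bullet> x)"
proof (rule Bochner_Integration.integrable_bound[OF integrable_mult_right[OF D_integrable, of R]])
  show "AE x in M. norm (D x \<bullet> x) \<le> norm (R * norm (D x))"
  proof (rule AE_I2)
    fix x assume "x \<in> space M"
    then have "norm x \<le> R" by simp
    then have "norm (D x) * norm x \<le> norm (D x) * R" by (intro mult_left_mono) auto
    with Cauchy_Schwarz_ineq2[of "D x" x] show "norm (D x \<bullet> x) \<le> norm (R * norm (D x))"
      using R by (simp add: abs_mult mult.commute)
  qed
qed measurable

text \<open>The cutoffs approximate the positive part of t^2 - |x|^2, whose gradient is -2x on the
  ball of radius t. The slopes are bounded by 2, so convergence is dominated.\<close>

lemma D_inner_self_ball: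
  assumes "0 < t" "t \<le> R"
  shows "(\<integral>x. indicator (ball 0 t) x * (D x \<bullet> x) \<partial>M) = 0"
proof (rule LIMSEQ_unique)
  have [measurable]: "cutoff_slope t k \<in> borel_measurable M" for k
  proof (rule borel_measurable_lebesgue_on)
    have [measurable]: "flat n \<in> borel_measurable borel" for n
      by (intro borel_measurable_continuous_onI flat_continuous)
    show "cutoff_slope t k \<in> borel_measurable borel"
      unfolding cutoff_slope_def[abs_def] Let_def by measurable
  qed
  show "(\<lambda>k. \<integral>x. cutoff_slope t k x * (D x \<bullet> x) \<partial>M) \<longlonglongrightarrow> (\<integral>x. indicator (ball 0 t) x * (D x \<bullet> x) \<partial>M)"
  proof (rule integral_dominated_convergence)
    show "integrable M (\<lambda>x. 2 * \<bar>D x \<bullet> x\<bar>)"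
      by (intro integrable_mult_right integrable_abs D_inner_self_integrable)
    show "AE x in M. (\<lambda>k. cutoff_slope t k x * (D x \<bullet> x)) \<longlonglongrightarrow> indicator (ball 0 t) x * (D x \<bullet> x)"
      using assms by (intro AE_I2 tendsto_mult cutoff_slope_tendsto) auto
    show "AE x in M. norm (cutoff_slope t k x * (D x \<bullet> x)) \<le> 2 * \<bar>D x \<bullet> x\<bar>" for k
      using cutoff_slope_bound[of t k] by (intro AE_I2) (auto simp: abs_mult intro!: mult_right_mono)
    show "(\<lambda>x. indicator (ball 0 t) x * (D x \<bullet> x)) \<in> borel_measurable M"
    proof (rule borel_measurable_times)
      show "indicator (ball 0 t) \<in> borel_measurable M"
        by (intro borel_measurable_lebesgue_on borel_measurable_indicator) simp
    qed measurable
  qed measurable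
  have "(\<integral>x. cutoff_slope t k x * (D x \<bullet> x) \<partial>M) = 0" for k
  proof -
    have "(\<integral>x. - 2 * (cutoff_slope t k x * (D x \<bullet> x)) \<partial>M) = 0"
      using D_grad_eq_0[OF cutoff_test_function[OF assms, of k]]
      by (simp add: grad_cutoff mult.assoc)
    then show ?thesis by simp
  qed
  then show "(\<lambda>k. \<integral>x. cutoff_slope t k x * (D x \<bullet> x) \<partial>M) \<longlonglongrightarrow> 0"
    by simp
qed

text \<open>The indicators of balls determine all radial weights. Integrability is asked of the
  product only, so \<gamma> may be singular at the origin, as the weights with a factor 1/|x| used
  below are.\<close>

lemma D_radial_eq_0:
  assumes [measurable]: "\<gamma> \<in> borel_measurable borel" and "\<And>t. 0 \<le> \<gamma> t"
    and "integrable M (\<lambda>x. \<gamma> (norm x) * (D x \<bullet> x))"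
  shows "(\<integral>x. \<gamma> (norm x) * (D x \<bullet> x) \<partial>M) = 0"
proof (rule integral_compose_eq_0[OF D_inner_self_integrable _ assms(1,2) _ assms(3)])
  show "norm \<in> borel_measurable M"
    by (rule borel_measurable_lebesgue_on) simp
  fix t :: real
  show "(\<integral>x. indicator {..<t} (norm x) * (D x \<bullet> x) \<partial>M) = 0"
  proof (cases "t \<le> 0")
    case True
    then have "(\<integral>x. indicator {..<t} (norm x) * (D x \<bullet> x) \<partial>M) = (\<integral>x. 0 \<partial>M)"
      by (intro Bochner_Integration.integral_cong) (auto simp: indicator_def not_less intro: order_trans)
    then show ?thesis by simp
  next
    case False
    have "(\<integral>x. indicator {..<t} (norm x) * (D x \<bullet> x) \<partial>M) = (\<integral>x. indicator (ball 0 (min t R)) x * (D x \<bullet> x) \<partial>M)"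
      by (intro Bochner_Integration.integral_cong) (auto simp: indicator_def)
    with False R show ?thesis using D_inner_self_ball[of "min t R"] by simp
  qed
qed

text \<open>With m = min F k, the radial field m^(q-1) x/|x| shows that the integral of m^q is at
  most that of |\<sigma>| m^(q-1). Young's inequality with (q-1) p = q then absorbs half of the left
  side. Truncation keeps the weight bounded and the absorbed term finite, while the bound is
  independent of k.\<close>

lemma truncated_F_bound:
  "(\<integral>x. min (F x) (real k) powr q \<partial>M) \<le> 2 * 2 powr (q - 1) * (\<integral>x. norm (\<sigma> x) powr q \<partial>M)"
proof -
  interpret finite_measure M by (rule finite_measure_lebesgue_on_ball)
  \<comment> \<open>Chosen so that \<epsilon>^(1-p) = 1/2, the fraction to be absorbed.\<close>
  define \<epsilon> :: real where "\<epsilon> = 2 powr (q - 1)"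
  have "(q - 1) * (1 - p) = - 1"
    using p by (simp add: q(2) divide_eq_eq)
  then have \<epsilon>: "\<epsilon> > 0" "\<epsilon> powr (1 - p) = 1 / 2"
    by (simp_all only: \<epsilon>_def powr_powr) (simp_all add: powr_minus_divide)
  define m where "m t = min (t * \<kappa> t) (real k)" for t
  define \<gamma> where "\<gamma> t = (if t > 0 then m t powr (q - 1) / t else 0)" for t
  have [measurable]: "\<gamma> \<in> borel_measurable borel" "m \<in> borel_measurable borel"
    unfolding \<gamma>_def[abs_def] m_def[abs_def] by measurable
  have m: "m (norm x) = min (F x) (real k)" "0 \<le> m (norm x)" for x :: 'a
    using F_nonneg[of x] by (auto simp: m_def F_def)
  have bnd: "\<bar>\<gamma> (norm x) * (D x \<bullet> x)\<bar> \<le> real k powr (q - 1) * norm (D x)" for x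
  proof (cases "x = 0")
    case False
    have "\<bar>\<gamma> (norm x) * (D x \<bullet> x)\<bar> \<le> m (norm x) powr (q - 1) / norm x * (norm (D x) * norm x)"
    proof -
      have "\<bar>\<gamma> (norm x) * (D x \<bullet> x)\<bar> = m (norm x) powr (q - 1) / norm x * \<bar>D x \<bullet> x\<bar>"
        using False by (simp add: \<gamma>_def abs_mult)
      then show ?thesis
        using Cauchy_Schwarz_ineq2[of "D x" x] by (simp only:) (intro mult_left_mono; simp)
    qed
    also have "\<dots> = m (norm x) powr (q - 1) * norm (D x)"
      using False by simp
    also have "\<dots> \<le> real k powr (q - 1) * norm (D x)"
      using m[of x] q(1) by (intro mult_right_mono powr_mono2) auto
    finally show ?thesis .
  qed simp
  have int: "integrable M (\<lambda>x. \<gamma> (norm x) * (D x \<bullet> x))"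
    by (rule Bochner_Integration.integrable_bound[OF integrable_mult_right[OF D_integrable, of "real k powr (q - 1)"]])
       (use bnd in \<open>auto\<close>)
  have intF: "integrable M (\<lambda>x. min (F x) (real k) powr q)"
  proof (rule Bochner_Integration.integrable_bound[OF integrable_const[of "real k powr q"]])
    show "AE x in M. norm (min (F x) (real k) powr q) \<le> norm (real k powr q)"
      using F_nonneg q(1) by (auto intro!: AE_I2 powr_mono2)
  qed measurable
  have lower: "min (F x) (real k) powr q / 2 - \<epsilon> * norm (\<sigma> x) powr q \<le> \<gamma> (norm x) * (D x \<bullet> x)" for x
  proof (cases "x = 0")
    case True
    then show ?thesis using \<epsilon> by (simp add: F_def \<gamma>_def min_def)
  next
    case False
    define y where "y = m (norm x) powr (q - 1)"
    have y: "y \<ge> 0" by (simp add: y_def)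
    have "norm (\<sigma> x) * y \<le> \<epsilon> * norm (\<sigma> x) powr q + (1 / 2) * y powr p"
      using weighted_Young_inequality[OF p \<epsilon>(1), of "norm (\<sigma> x)" y] y \<epsilon>(2) by (simp add: q_def)
    also have "y powr p = m (norm x) powr q"
      by (simp add: y_def powr_powr q(3))
    finally have young: "norm (\<sigma> x) * y \<le> \<epsilon> * norm (\<sigma> x) powr q + m (norm x) powr q / 2"
      by simp
    have "- (norm (\<sigma> x) * norm x) \<le> \<sigma> x \<bullet> x"
      using Cauchy_Schwarz_ineq2[of "\<sigma> x" x] by linarith
    then have "y * (- norm (\<sigma> x)) \<le> y * ((\<sigma> x \<bullet> x) / norm x)"
      using False y by (intro mult_left_mono) (auto simp: field_simps)
    moreover have "m (norm x) powr q \<le> y * F x"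
    proof -
      have "m (norm x) powr q = y * m (norm x)"
        using m(2)[of x] by (cases "m (norm x) = 0") (auto simp: y_def powr_diff)
      also have "\<dots> \<le> y * F x"
        using y m(1)[of x] by (intro mult_left_mono) auto
      finally show ?thesis .
    qed
    moreover have "\<gamma> (norm x) * (D x \<bullet> x) = y * ((\<sigma> x \<bullet> x) / norm x) + y * F x"
      using False by (simp add: \<gamma>_def D_def F_def y_def inner_add_left field_simps
          power2_norm_eq_inner[symmetric] power2_eq_square)
    ultimately show ?thesis
      using young m(1)[of x] by (simp add: mult.commute)
  qed
  have "(\<integral>x. min (F x) (real k) powr q \<partial>M) / 2 - \<epsilon> * (\<integral>x. norm (\<sigma> x) powr q \<partial>M)
      = (\<integral>x. min (F x) (real k) powr q / 2 - \<epsilon> * norm (\<sigma> x) powr q \<partial>M)"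
    using intF \<sigma>_Lq by simp
  also have "\<dots> \<le> (\<integral>x. \<gamma> (norm x) * (D x \<bullet> x) \<partial>M)"
    using intF \<sigma>_Lq int lower by (intro integral_mono) auto
  also have "\<dots> = 0"
    by (intro D_radial_eq_0 int) (auto simp: \<gamma>_def)
  finally show ?thesis by (simp add: \<epsilon>_def)
qed

text \<open>Fatou's lemma along the truncations, which are eventually constant at each point and
  whose bound is uniform in k.\<close>

lemma F_Lq: "integrable M (\<lambda>x. F x powr q)"
proof (rule integrableI_bounded)
  interpret finite_measure M by (rule finite_measure_lebesgue_on_ball)
  define B where "B = 2 * 2 powr (q - 1) * (\<integral>x. norm (\<sigma> x) powr q \<partial>M)"
  have le: "(\<integral>\<^sup>+x. ennreal (min (F x) (real k) powr q) \<partial>M) \<le> ennreal B" for k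
  proof -
    have "integrable M (\<lambda>x. min (F x) (real k) powr q)"
    proof (rule Bochner_Integration.integrable_bound[OF integrable_const[of "real k powr q"]])
      show "AE x in M. norm (min (F x) (real k) powr q) \<le> norm (real k powr q)"
        using F_nonneg q(1) by (auto intro!: AE_I2 powr_mono2)
    qed measurable
    then have "(\<integral>\<^sup>+x. ennreal (min (F x) (real k) powr q) \<partial>M) = ennreal (\<integral>x. min (F x) (real k) powr q \<partial>M)"
      by (intro nn_integral_eq_integral) auto
    also have "\<dots> \<le> ennreal B"
      unfolding B_def by (intro ennreal_leI truncated_F_bound)
    finally show ?thesis .
  qed
  have lim: "liminf (\<lambda>k. ennreal (min (F x) (real k) powr q)) = ennreal (F x powr q)" for x
  proof (rule lim_imp_Liminf)
    obtain n where n: "F x \<le> real n" using real_arch_simple by blast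
    have "\<forall>\<^sub>F k in sequentially. ennreal (min (F x) (real k) powr q) = ennreal (F x powr q)"
      using eventually_ge_at_top[of n] by eventually_elim (use n in \<open>simp add: min_absorb1\<close>)
    then show "(\<lambda>k. ennreal (min (F x) (real k) powr q)) \<longlonglongrightarrow> ennreal (F x powr q)"
      by (rule tendsto_eventually)
  qed simp
  have "(\<integral>\<^sup>+x. ennreal (norm (F x powr q)) \<partial>M) = (\<integral>\<^sup>+x. liminf (\<lambda>k. ennreal (min (F x) (real k) powr q)) \<partial>M)"
    by (simp add: lim)
  also have "\<dots> \<le> liminf (\<lambda>k. \<integral>\<^sup>+x. ennreal (min (F x) (real k) powr q) \<partial>M)"
    by (intro nn_integral_liminf) measurable
  also have "\<dots> \<le> liminf (\<lambda>k::nat. ennreal B)"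
    by (intro Liminf_mono always_eventually allI le)
  also have "\<dots> < \<infinity>"
    by (simp add: Liminf_const)
  finally show "(\<integral>\<^sup>+x. ennreal (norm (F x powr q)) \<partial>M) < \<infinity>" .
qed measurable

lemma D_Lq: "integrable M (\<lambda>x. norm (D x) powr (p / (p - 1)))"
proof -
  have "norm ((- \<kappa> (norm x)) *\<^sub>R x) = F x" for x
    using \<kappa>_nonneg[of "norm x"] by (simp add: F_def)
  then have "integrable M (\<lambda>x. norm (\<sigma> x - (- \<kappa> (norm x)) *\<^sub>R x) powr q)"
    using q(1) \<sigma>_Lq F_Lq by (intro integrable_norm_diff_powr) auto
  then show ?thesis by (simp add: D_def q_def)
qed

text \<open>In L^p, w is a limit of test gradients, all orthogonal to D. Passing to the limit needs
  D in the dual space, which is what the truncation argument provides.\<close>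

lemma D_w_eq_0: "(\<integral>x. D x \<bullet> w x \<partial>M) = 0"
proof -
  interpret finite_measure M by (rule finite_measure_lebesgue_on_ball)
  obtain \<phi> where \<phi>: "\<And>n::nat. \<phi> n \<in> test_functions (ball 0 R)"
    and lim: "(\<lambda>n. Lp_norm p (ball 0 R) (\<lambda>x. grad (\<phi> n) x - w x)) \<longlonglongrightarrow> 0"
    using sol by (auto simp: weak_solution_def W1p_0_def w_def)
  have [measurable]: "grad (\<phi> n) \<in> borel_measurable M" for n
    using \<phi>[of n] smooth_continuous_on_grad[of "\<phi> n" UNIV]
    by (intro borel_measurable_lebesgue_on borel_measurable_continuous_onI) (auto simp: test_functions_def)
  show ?thesis
  proof (rule integral_inner_eq_0_closure[OF p, of D M w "\<lambda>n. grad (\<phi> n)"])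
    show "integrable M (\<lambda>x. norm (grad (\<phi> n) x) powr p)" for n
    proof -
      obtain B where B: "B \<ge> 0" "\<And>x. norm (grad (\<phi> n) x) \<le> B"
        using test_functionE[OF \<phi>[of n]] by metis
      show ?thesis
        by (rule Bochner_Integration.integrable_bound[OF integrable_const[of "B powr p"]])
           (use B p in \<open>auto intro!: AE_I2 powr_mono2\<close>)
    qed
    have "(\<lambda>n. Lp_norm p (ball 0 R) (\<lambda>x. grad (\<phi> n) x - w x) powr p) \<longlonglongrightarrow> 0"
      by (rule tendsto_zero_powrI[OF lim tendsto_const]) (use p in \<open>auto simp: Lp_norm_def\<close>)
    moreover have "Lp_norm p (ball 0 R) (\<lambda>x. grad (\<phi> n) x - w x) powr p
        = (\<integral>x. norm (grad (\<phi> n) x - w x) powr p \<partial>M)" for n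
      using p by (simp add: Lp_norm_def powr_powr)
    ultimately show "(\<lambda>n. \<integral>x. norm (grad (\<phi> n) x - w x) powr p \<partial>M) \<longlonglongrightarrow> 0"
      by simp
  qed (use D_Lq w_Lp D_grad_eq_0[OF \<phi>] in auto)
qed

text \<open>
  The gradient \<open>g\<close> of the radial solution satisfies \<open>H (p - 1) g = \<sigma> - D\<close>, and \<open>D\<close> is orthogonal both
  to \<open>w\<close> and to \<open>g\<close>.
\<close>

lemma norm_gradient_le: "AE x in M. norm (w x) \<le> 1 + F x powr (1 / (p - 1))"
proof -
  interpret finite_measure M by (rule finite_measure_lebesgue_on_ball)
  define \<gamma> where "\<gamma> t = (if t > 0 then (1 + (t * \<kappa> t) powr (1 / (p - 1))) / t else 0)" for t
  define g where "g x = (- \<gamma> (norm x)) *\<^sub>R x" for x :: 'a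
  have [measurable]: "\<gamma> \<in> borel_measurable borel"
    unfolding \<gamma>_def[abs_def] by measurable
  have [measurable]: "g \<in> borel_measurable M"
    unfolding g_def[abs_def] by measurable
  have g: "g x = (- ((1 + F x powr (1 / (p - 1))) / norm x)) *\<^sub>R x" for x
    by (simp add: g_def \<gamma>_def F_def)
  have norm_g: "norm (g x) = 1 + F x powr (1 / (p - 1))" if "x \<noteq> 0" for x
  proof -
    have "1 + F x powr (1 / (p - 1)) \<ge> 0" by (simp add: add_nonneg_nonneg)
    then show ?thesis using that by (simp add: g abs_of_nonneg)
  qed
  have norm_g_le: "norm (g x) powr p \<le> 2 powr p * (1 + F x powr q)" for x
  proof (cases "x = 0")
    case False
    have "(F x powr (1 / (p - 1))) powr p = F x powr q"
      by (simp add: powr_powr q_def)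
    then show ?thesis
      using norm_diff_powr_le[of p 1 "- (F x powr (1 / (p - 1)))"] norm_g[OF False] p
      by (simp add: abs_of_nonneg add_nonneg_nonneg)
  qed (simp add: g)
  have g_Lp: "integrable M (\<lambda>x. norm (g x) powr p)"
  proof (rule Bochner_Integration.integrable_bound)
    show "integrable M (\<lambda>x. 2 powr p * (1 + F x powr q))"
      using F_Lq by (intro integrable_mult_right Bochner_Integration.integrable_add) auto
    show "AE x in M. norm (norm (g x) powr p) \<le> norm (2 powr p * (1 + F x powr q))"
      using norm_g_le by (auto intro!: AE_I2 order_trans[OF _ abs_ge_self])
  qed measurable
  have Dg: "integrable M (\<lambda>x. D x \<bullet> g x)" and Dw: "integrable M (\<lambda>x. D x \<bullet> w x)"
    by (rule integrable_inner[OF p]; use D_Lq g_Lp w_Lp in measurable)+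
  have eq: "D x \<bullet> g x = - (\<gamma> (norm x) * (D x \<bullet> x))" for x
    by (simp add: g_def)
  \<comment> \<open>The sign of g stays outside so that the weight is non-negative; integrability of
    the product comes from D in L^q and g in L^p.\<close>
  have "(\<integral>x. \<gamma> (norm x) * (D x \<bullet> x) \<partial>M) = 0"
    using Dg by (intro D_radial_eq_0) (auto simp: eq \<gamma>_def add_nonneg_nonneg)
  then have "(\<integral>x. D x \<bullet> g x \<partial>M) = 0"
    by (simp add: eq)
  then have zero: "(\<integral>x. D x \<bullet> (w x - g x) \<partial>M) = 0"
    using D_w_eq_0 Dg Dw by (simp add: inner_diff_right)
  have DH: "D x = H (p - 1) (w x) - H (p - 1) (g x)" if "x \<noteq> 0" for x
    unfolding g H_radial[OF p F_nonneg that] using that by (simp add: D_def \<sigma>_def F_def)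
  \<comment> \<open>A non-negative integrand with zero integral vanishes almost everywhere, which is
    the equality case of monotonicity.\<close>
  have "AE x in M. 0 \<le> D x \<bullet> (w x - g x)"
    using AE_M_nonzero
    by (auto simp: DH H_monotone p elim!: eventually_mono)
  then have "AE x in M. D x \<bullet> (w x - g x) = 0"
    using integral_nonneg_eq_0_iff_AE[of M "\<lambda>x. D x \<bullet> (w x - g x)"] zero Dg Dw
    by (simp add: inner_diff_right)
  then show ?thesis
    using AE_M_nonzero
  proof eventually_elim
    fix x assume "D x \<bullet> (w x - g x) = 0" "x \<noteq> 0"
    then have "norm (w x) \<le> norm (g x)"
      using p by (intro H_eq_imp_norm_le[of "p - 1"]) (auto simp: DH norm_g)
    then show "norm (w x) \<le> 1 + F x powr (1 / (p - 1))"
      using \<open>x \<noteq> 0\<close> by (simp add: norm_g)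
  qed
qed

section \<open>Regularity of the gradient from the pointwise bound\<close>

lemma gradient_in_Linf:
  assumes "a = 1"
  shows "w \<in> Linf_space (ball 0 R)"
proof -
  obtain B where B: "B \<ge> 0" "\<And>x. x \<noteq> 0 \<Longrightarrow> F x \<le> B * norm x powr (1 - a)"
    using F_bound by blast
  \<comment> \<open>For a = 1 the weight |x|^(1-a) is 1 off the origin, so F is bounded by
    B.\<close>
  have "AE x in M. norm (w x) \<le> 1 + B powr (1 / (p - 1))"
    using norm_gradient_le AE_M_nonzero
  proof eventually_elim
    fix x assume "norm (w x) \<le> 1 + F x powr (1 / (p - 1))" "x \<noteq> 0"
    moreover from this B(2)[of x] have "F x powr (1 / (p - 1)) \<le> B powr (1 / (p - 1))"
      using assms F_nonneg[of x] p by (intro powr_mono2) auto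
    ultimately show "norm (w x) \<le> 1 + B powr (1 / (p - 1))" by linarith
  qed
  with w_Lp show ?thesis by (auto simp: Linf_space_def)
qed

text \<open>The s-th power of the gradient is dominated by a constant plus a multiple of
  |x|^(-(a-1)s/(p-1)); the second hypothesis is the integrability of this weight.\<close>

lemma gradient_in_Lp:
  assumes s: "s > 0" "(a - 1) * (s / (p - 1)) < real DIM('a)"
  shows "w \<in> Lp_space s (ball 0 R)"
proof -
  interpret finite_measure M by (rule finite_measure_lebesgue_on_ball)
  obtain B where B: "B \<ge> 0" "\<And>x. x \<noteq> 0 \<Longrightarrow> F x \<le> B * norm x powr (1 - a)"
    using F_bound by blast
  define e where "e = s / (p - 1)"
  have e: "e > 0" using s p by (simp add: e_def)
  have "integrable M (\<lambda>x. norm x powr (- ((a - 1) * e)))"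
    using integrable_norm_powr_ball[of "(a - 1) * e" R, where 'a='a] s
    by (simp add: integrable_lebesgue_on_iff e_def)
  then have int: "integrable M (\<lambda>x. 2 powr s * (1 + B powr e * norm x powr (- ((a - 1) * e))))"
    by (intro integrable_mult_right Bochner_Integration.integrable_add integrable_const)
  have "integrable M (\<lambda>x. norm (w x) powr s)"
  proof (rule Bochner_Integration.integrable_bound[OF int])
    show "AE x in M. norm (norm (w x) powr s) \<le> norm (2 powr s * (1 + B powr e * norm x powr (- ((a - 1) * e))))"
      using norm_gradient_le AE_M_nonzero
    proof eventually_elim
      fix x assume x: "norm (w x) \<le> 1 + F x powr (1 / (p - 1))" "x \<noteq> 0"
      have "norm (w x) powr s \<le> (1 + F x powr (1 / (p - 1))) powr s"
        using x s by (intro powr_mono2) auto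
      also have "\<dots> \<le> 2 powr s * (1 + (F x powr (1 / (p - 1))) powr s)"
        using norm_diff_powr_le[of s 1 "- (F x powr (1 / (p - 1)))"] s
        by (simp add: abs_of_nonneg add_nonneg_nonneg)
      also have "(F x powr (1 / (p - 1))) powr s = F x powr e"
        by (simp add: powr_powr e_def)
      also have "F x powr e \<le> (B * norm x powr (1 - a)) powr e"
        using B x e F_nonneg[of x] by (intro powr_mono2) auto
      also have "(B * norm x powr (1 - a)) powr e = B powr e * norm x powr (- ((a - 1) * e))"
        using B by (simp add: powr_mult powr_powr algebra_simps)
      finally show "norm (norm (w x) powr s) \<le> norm (2 powr s * (1 + B powr e * norm x powr (- ((a - 1) * e))))"
        by (simp add: mult_left_mono)
    qed
  qed measurable
  with w_Lp show ?thesis by (simp add: Lp_space_def)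
qed

end

section \<open>From the given data to the radial setting\<close>

lemma radial_solution_exists:
  fixes f u :: "'a::euclidean_space \<Rightarrow> real"
  assumes R: "R > 0" and p: "p > 1" and nonneg: "\<forall>x\<in>ball 0 R. f x \<ge> 0"
    and radial: "radially_decreasing R f" and sol: "weak_solution p R f u"
    and r: "r > 1" and f: "f \<in> weak_Lorentz r (ball 0 R)"
  shows "\<exists>C h. radial_solution p R C (real DIM('a) / r) f u h"
proof -
  obtain h where h: "antimono_on {0<..<R} h" "\<And>x. x \<in> ball 0 R - {0} \<Longrightarrow> f x = h (norm x)"
    using radial by (auto simp: radially_decreasing_def)
  have h_nonneg: "0 \<le> h t" if "0 < t" "t < R" for t
  proof -
    have "0 \<le> t" using that by simp
    then obtain x :: 'a where x: "norm x = t" using vector_choose_size by blast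
    then have "x \<in> ball 0 R - {0}" using that by auto
    then have "0 \<le> f x" "f x = h (norm x)" using nonneg h(2) by blast+
    with x show ?thesis by simp
  qed
  obtain C where C: "C \<ge> 0" "\<And>t. 0 < t \<Longrightarrow> t < R \<Longrightarrow> h t \<le> C * t powr (- (real DIM('a) / r))"
    using radial_weak_Lorentz_bound[OF _ f h h_nonneg] r by auto
  \<comment> \<open>The extension by zero leaves f unchanged off the origin; C \<ge> 0 keeps the
    power bound valid where \<open>h0\<close> vanishes.\<close>
  define h0 where "h0 t = indicator {0<..<R} t * h t" for t
  have "radial_solution p R C (real DIM('a) / r) f u h0"
  proof
    \<comment> \<open>Borel measurability of the profile comes from monotonicity, applied to
      -h.\<close>
    have "mono_on {0<..<R} (\<lambda>t. - h t)"
      using h(1) by (auto simp: monotone_on_def)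
    then have "(\<lambda>t. - (- h t)) \<in> borel_measurable (restrict_space borel {0<..<R})"
      by (intro borel_measurable_uminus borel_measurable_mono_on_fnc)
    then show "h0 \<in> borel_measurable borel"
      by (simp add: borel_measurable_restrict_space_iff h0_def[abs_def])
    show "real DIM('a) / r < real DIM('a)"
      using r by (simp add: divide_less_eq)
  qed (use R p sol C h h_nonneg in \<open>auto simp: h0_def indicator_def\<close>)
  then show ?thesis by blast
qed

theorem corollary1p2:
  fixes R p :: real and f u :: "'a::euclidean_space \<Rightarrow> real"
  assumes "DIM('a) \<ge> 2" and "R > 0" and "p > 1"
    and "\<forall>x\<in>ball 0 R. f x \<ge> 0"
    and "radially_decreasing R f"
    and "weak_solution p R f u"
  shows "(\<forall>r. 1 < r \<and> r < real DIM('a) \<and> f \<in> weak_Lorentz r (ball 0 R) \<longrightarrow>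
           (\<forall>q. 0 < q \<and> q < real DIM('a) * r * (p - 1) / (real DIM('a) - r) \<longrightarrow>
             weak_grad (ball 0 R) u \<in> Lp_space q (ball 0 R)))
       \<and> (f \<in> weak_Lorentz (real DIM('a)) (ball 0 R) \<longrightarrow>
           weak_grad (ball 0 R) u \<in> Linf_space (ball 0 R))"
proof (intro conjI allI impI; (elim conjE)?)
  fix r q :: real
  assume r: "1 < r" "r < real DIM('a)" and f: "f \<in> weak_Lorentz r (ball 0 R)"
    and q_bounds: "0 < q" "q < real DIM('a) * r * (p - 1) / (real DIM('a) - r)"
  obtain C h where "radial_solution p R C (real DIM('a) / r) f u h"
    using radial_solution_exists[OF assms(2-6) r(1) f] by blast
  then interpret radial_solution p R C "real DIM('a) / r" f u h .
  \<comment> \<open>With a = N/r the integrability condition of \<open>gradient_in_Lp\<close> is the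
    stated range of q; r < N keeps the inequality direction when denominators are cleared.\<close>
  have "q * (real DIM('a) - r) < real DIM('a) * (r * (p - 1))"
    using q_bounds r by (simp add: less_divide_eq mult.assoc)
  then have "q * (real DIM('a) - r) / (r * (p - 1)) < real DIM('a)"
    using r \<open>p > 1\<close> by (simp add: divide_less_eq)
  moreover have "(real DIM('a) / r - 1) * (q / (p - 1)) = q * (real DIM('a) - r) / (r * (p - 1))"
    using r \<open>p > 1\<close> by (simp add: field_simps)
  ultimately show "weak_grad (ball 0 R) u \<in> Lp_space q (ball 0 R)"
    using gradient_in_Lp[OF q_bounds(1)] by (simp add: w_def)
next
  assume f: "f \<in> weak_Lorentz (real DIM('a)) (ball 0 R)"
  \<comment> \<open>N \<ge> 2 makes r = N admissible as an exponent above 1; the decay exponent is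
    then N/N = 1.\<close>
  have N: "real DIM('a) > 1" using assms(1) by simp
  obtain C h where "radial_solution p R C (real DIM('a) / real DIM('a)) f u h"
    using radial_solution_exists[OF assms(2-6) N f] by blast
  then interpret radial_solution p R C "real DIM('a) / real DIM('a)" f u h .
  show "weak_grad (ball 0 R) u \<in> Linf_space (ball 0 R)"
    using gradient_in_Linf by (simp add: w_def)
qed

end
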